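(* Let $\theta=0$, $r>1$, and let $\{Z_n\}_{n\ge0}$ be a (possibly defective) GW$^{\,\theta}$-process with parameters $(0,r,a_n,c_n)_{n\ge1}$. Then $$q=r-r^{A}D,\quad q_\Delta=1-r+(r-1)^{A}D,\quad Q=1-(r^{A}-(r-1)^{A})D,$$ where $A=\lim_{n\to\infty}A_n\in[0,1)$ and $D=\prod_{n\ge1}(r-c_n)^{A_{n-1}-A_n}$. (i) If $A=0$, then $Q=1$ and $$\mathrm{P}(\tau>n)\sim(\ln r-\ln(r-1))A_nD_n.$$ Moreover, $$\mathrm{E}(Z_n|\tau>n)\to\frac{(r-1)^{-1}}{\ln r-\ln(r-1)},\qquad \mathrm{E}(s^{Z_n}|\tau>n)\to\frac{\ln r-\ln(r-s)}{\ln r-\ln(r-1)},\quad 0\le s\le1.$$ (ii) If $A\in(0,1)$, then $Q<1$, $$(r-1)^{1-A}\le D\le r^{1-A},\qquad \mathrm{E}(Z_n;\tau_\Delta>n)\to A(r-1)^{A-1}D,$$ and $Z_n$ converges almost surely to a random variable $Z_\infty$ taking values in the set $\{\Delta,0,1,2,\ldots\}$, with $$\mathrm{P}(Z_\infty=\Delta)=1-r+(r-1)^{A}D,$$ $$\mathrm{E}(s^{Z_\infty};Z_\infty\ne\Delta)=r-(r-s)^{A}D,\quad 0\le s\le1.$$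
   Context: All limits and asymptotic equivalences are as $n\to\infty$. Let $\theta=0$, $r>1$, and let $(a_n,c_n)_{n\ge1}$ be real sequences with $0<a_n<1$ and $0\le c_n\le1$ for all $n\ge1$. Put $$f_n(s)=r-(r-c_n)^{1-a_n}(r-s)^{a_n},\quad 0\le s\le1.$$ Each $f_n(s)=\sum_{j\ge0}p_n(j)s^j$ is a possibly defective probability generating function: $p_n(j)\ge0$ and $f_n(1)\le1$. The GW$^{\,\theta}$-process with parameters $(0,r,a_n,c_n)_{n\ge1}$ is the Galton-Watson process in a varying environment with $Z_0=1$, in which each individual of generation $n-1$, independently of everything else, has $j$ offspring with probability $p_n(j)$, $j\ge0$, and with the remaining probability $1-f_n(1)$ sends the entire process to an additional absorbing state $\Delta$ at time $n$ (so $Z_n=\Delta$ if some individual of generation $n-1$ does so, or if $Z_{n-1}=\Delta$; otherwise $Z_n$ is the total number of offspring). The state $0$ is also absorbing. With $F_n=f_1\circ\cdots\circ f_n$, one has $\mathrm{E}(s^{Z_n};Z_n\ne\Delta)=F_n(s)$, $\mathrm{P}(Z_n=0)=F_n(0)$, $\mathrm{P}(Z_n=\Delta)=1-F_n(1)$. Notation: $\mathrm{E}(X;E)$ is the expectation of $X$ times the indicator of the event $E$. $\tau_0$ and $\tau_\Delta$ are the absorption times at $0$ and at $\Delta$ respectively, $\tau=\min(\tau_0,\tau_\Delta)$, $q=\mathrm{P}(\tau_0<\infty)$, $q_\Delta=\mathrm{P}(\tau_\Delta<\infty)$, $Q=\mathrm{P}(\tau<\infty)=q+q_\Delta$. $A_0=1$,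 $A_n=\prod_{i=1}^na_i$, $D_n=\prod_{i=1}^n(r-c_i)^{A_{i-1}-A_i}$, $D=\lim D_n$. *)

theory Defs
  imports "HOL-Probability.Probability" "HOL-Library.Landau_Symbols" "HOL-Library.Extended_Nat"
begin

text \<open>States of the process: \<open>Some k\<close> means that the generation has size \<open>k\<close>, and \<open>None\<close> is
  the additional absorbing state \<open>\<Delta>\<close>.\<close>

text \<open>Total offspring of individuals \<open>0, \<dots>, k - 1\<close>, where \<open>x i\<close> is the outcome for
  individual \<open>i\<close>; a single outcome \<open>None\<close> sends the whole process to \<open>\<Delta>\<close>.\<close>

definition total_offspring :: "(nat \<Rightarrow> nat option) \<Rightarrow> nat \<Rightarrow> nat option" where
  "total_offspring x k =
     (if \<exists>i<k. x i = None then None else Some (\<Sum>i<k. the (x i)))"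

text \<open>Galton-Watson process in a varying environment with possibly defective offspring laws:
  \<open>\<xi> n i\<close> is the outcome for individual \<open>i\<close> of generation \<open>n - 1\<close>, for \<open>n \<ge> 1\<close>. The value
  \<open>None\<close> carries the remaining probability \<open>1 - (\<Sum>j. p n j)\<close>.\<close>

definition GW_varying ::
    "'w measure \<Rightarrow> (nat \<Rightarrow> nat \<Rightarrow> real) \<Rightarrow> (nat \<Rightarrow> 'w \<Rightarrow> nat option) \<Rightarrow> bool" where
  "GW_varying M p Z \<longleftrightarrow> prob_space M \<and>
     (\<exists>\<xi> :: nat \<Rightarrow> nat \<Rightarrow> 'w \<Rightarrow> nat option.
        prob_space.indep_vars M (\<lambda>_. count_space UNIV) (\<lambda>(n, i). \<xi> n i) ({1..} \<times> UNIV) \<and>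
        (\<forall>n\<ge>1. \<forall>i j. \<P>(\<omega> in M. \<xi> n i \<omega> = Some j) = p n j) \<and>
        (\<forall>\<omega>\<in>space M. Z 0 \<omega> = Some 1) \<and>
        (\<forall>n. \<forall>\<omega>\<in>space M. Z (Suc n) \<omega> =
           (case Z n \<omega> of
              None \<Rightarrow> None
            | Some k \<Rightarrow> total_offspring (\<lambda>i. \<xi> (Suc n) i \<omega>) k)))"

definition theta0_pgf :: "real \<Rightarrow> real \<Rightarrow> real \<Rightarrow> real \<Rightarrow> real" where
  "theta0_pgf r a c s = r - (r - c) powr (1 - a) * (r - s) powr a"

text \<open>The power series identity on \<open>[0, 1]\<close> determines \<open>p n\<close> uniquely.\<close>

definition GW_theta0 ::
    "'w measure \<Rightarrow> real \<Rightarrow> (nat \<Rightarrow> real) \<Rightarrow> (nat \<Rightarrow> real) \<Rightarrow> (nat \<Rightarrow> 'w \<Rightarrow> nat option) \<Rightarrow> bool" where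
  "GW_theta0 M r a c Z \<longleftrightarrow>
     (\<exists>p. (\<forall>n\<ge>1. \<forall>s\<in>{0..1}. (\<lambda>j. p n j * s ^ j) sums theta0_pgf r (a n) (c n) s) \<and>
          GW_varying M p Z)"

text \<open>The infimum of the empty set of times is \<open>\<infinity>\<close>.\<close>

definition absorption_time :: "(nat \<Rightarrow> 'w \<Rightarrow> 's) \<Rightarrow> 's \<Rightarrow> 'w \<Rightarrow> enat" where
  "absorption_time Z x \<omega> = Inf {enat n |n. Z n \<omega> = x}"

definition A_seq :: "(nat \<Rightarrow> real) \<Rightarrow> nat \<Rightarrow> real" where
  "A_seq a n = (\<Prod>i=1..n. a i)"

definition D_seq :: "real \<Rightarrow> (nat \<Rightarrow> real) \<Rightarrow> (nat \<Rightarrow> real) \<Rightarrow> nat \<Rightarrow> real" where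
  "D_seq r a c n = (\<Prod>i=1..n. (r - c i) powr (A_seq a (i - 1) - A_seq a i))"

text \<open>\<open>expectation_on M X P\<close> is \<open>E(X; P)\<close>, and \<open>expectation_given M X P\<close> is \<open>E(X | P)\<close>
  for an event \<open>P\<close> of positive probability.\<close>

definition expectation_on :: "'w measure \<Rightarrow> ('w \<Rightarrow> real) \<Rightarrow> ('w \<Rightarrow> bool) \<Rightarrow> real" where
  "expectation_on M X P = (LINT \<omega>:{\<omega>\<in>space M. P \<omega>}|M. X \<omega>)"

definition expectation_given :: "'w measure \<Rightarrow> ('w \<Rightarrow> real) \<Rightarrow> ('w \<Rightarrow> bool) \<Rightarrow> real" where
  "expectation_given M X P = expectation_on M X P / \<P>(\<omega> in M. P \<omega>)"

end

theory Submission imports Defs begin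

text \<open>Conditioning on generation \<open>n\<close> gives \<open>E(s^Z_(n+1); Z_(n+1) \<noteq> \<Delta>) = E(f_(n+1)(s)^Z_n; Z_n \<noteq> \<Delta>)\<close>,
  and \<open>r - f_n(s)\<close> is a multiple of a power of \<open>r - s\<close>, so that \<open>E(s^Z_n; Z_n \<noteq> \<Delta>) = r - D_n (r - s)^(A_n)\<close>.
  Putting \<open>s = 0\<close> and \<open>s = 1\<close> and differentiating at \<open>s = 1\<close> gives the absorption probabilities and the
  mean; the limits for \<open>A = 0\<close> come from the derivative of \<open>x \<mapsto> r^x - (r - s)^x\<close> at \<open>0\<close>.

  For \<open>A > 0\<close> the process is almost surely eventually constant by Borel-Cantelli: a change at time
  \<open>n + 1\<close> requires an individual without exactly one child, so that its probability is at most
  \<open>(1 - p_(n+1)(1)) E(Z_n; Z_n \<noteq> \<Delta>)\<close>. The mean is bounded, and \<open>1 - p_n(1) \<le> 1 - f_n'(0)\<close> is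
  at most a constant times \<open>1 - a_n\<close>, which is summable because \<open>\<Prod> a_n = A > 0\<close>.\<close>

section \<open>Galton-Watson processes with killing\<close>

text \<open>Replaces conditional expectation given \<open>X\<close>: as \<open>X\<close> has
  countably many values, an integral is the sum of its parts over the level sets. It is applied with
  \<open>X = Z n\<close>.\<close>

lemma (in prob_space) integral_eqI_countable_fibres:
  fixes X :: "'a \<Rightarrow> 'b :: countable" and f g :: "'a \<Rightarrow> real"
  assumes X [measurable]: "X \<in> M \<rightarrow>\<^sub>M count_space UNIV"
    and f: "integrable M f" and g: "integrable M g"
    and eq: "\<And>x. (\<integral>\<omega>. indicator {x} (X \<omega>) * f \<omega> \<partial>M) = (\<integral>\<omega>. indicator {x} (X \<omega>) * g \<omega> \<partial>M)"
  shows "(\<integral>\<omega>. f \<omega> \<partial>M) = (\<integral>\<omega>. g \<omega> \<partial>M)"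
proof -
  \<comment> \<open>Level sets are numbered through \<open>to_nat\<close> to form a sequence;
    numbers outside its range give empty sets.\<close>
  define A where "A i = {\<omega> \<in> space M. to_nat (X \<omega>) = i}" for i
  have A [measurable]: "A i \<in> sets M" for i
    unfolding A_def by measurable
  have un: "(\<Union>i. A i) = space M"
    by (auto simp: A_def)
  have suminf: "(\<integral>\<omega>. h \<omega> \<partial>M) = (\<Sum>i. (LINT \<omega>:A i|M. h \<omega>))" if "integrable M h" for h :: "'a \<Rightarrow> real"
  proof -
    have "(\<integral>\<omega>. h \<omega> \<partial>M) = (LINT \<omega>:(\<Union>i. A i)|M. h \<omega>)"
      using that by (simp add: un set_integral_space)
    also have "\<dots> = (\<Sum>i. (LINT \<omega>:A i|M. h \<omega>))"
    proof (rule lebesgue_integral_countable_add)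
      show "set_integrable M (\<Union>i. A i) h"
        using integrable_mult_indicator[OF sets.top that] by (simp add: un set_integrable_def)
    qed (auto simp: A_def)
    finally show ?thesis .
  qed
  have "(LINT \<omega>:A i|M. f \<omega>) = (LINT \<omega>:A i|M. g \<omega>)" for i
  proof (cases "\<exists>x :: 'b. to_nat x = i")
    case True
    then obtain x :: 'b where x: "to_nat x = i" by auto
    have "(LINT \<omega>:A i|M. h \<omega>) = (\<integral>\<omega>. indicator {x} (X \<omega>) * h \<omega> \<partial>M)" for h :: "'a \<Rightarrow> real"
      unfolding set_lebesgue_integral_def
      by (intro Bochner_Integration.integral_cong) (auto simp: A_def x[symmetric] indicator_def)
    then show ?thesis using eq by simp
  next
    case False
    then have "A i = {}" by (auto simp: A_def)
    then show ?thesis by (simp add: set_lebesgue_integral_def)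
  qed
  then show ?thesis
    by (simp add: suminf f g)
qed

section \<open>Total offspring and powers that vanish at \<Delta>\<close>

lemma total_offspring_0: "total_offspring x 0 = Some 0"
  by (simp add: total_offspring_def)

lemma total_offspring_Suc:
  "total_offspring x (Suc k) =
     (case total_offspring x k of None \<Rightarrow> None | Some m \<Rightarrow> map_option ((+) m) (x k))"
  by (cases "x k") (auto simp: total_offspring_def less_Suc_eq)

lemma measurable_total_offspring:
  assumes "\<And>i. i < k \<Longrightarrow> x i \<in> N \<rightarrow>\<^sub>M count_space UNIV"
  shows "(\<lambda>\<omega>. total_offspring (\<lambda>i. x i \<omega>) k) \<in> N \<rightarrow>\<^sub>M count_space UNIV"
  using assms
proof (induction k)
  case (Suc k)
  have [measurable]: "(\<lambda>\<omega>. total_offspring (\<lambda>i. x i \<omega>) k) \<in> N \<rightarrow>\<^sub>M count_space UNIV"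
    "x k \<in> N \<rightarrow>\<^sub>M count_space UNIV"
    using Suc by auto
  show ?case
    unfolding total_offspring_Suc
    by (rule measurable_compose_countable[where f = "\<lambda>y \<omega>. case y of None \<Rightarrow> None | Some m \<Rightarrow> map_option ((+) m) (x k \<omega>)"])
       (auto split: option.split)
qed (simp add: total_offspring_0)

text \<open>Encodes the convention s^\<Delta> = 0, so that its expectation is E(s^X; X \<noteq>
  \<Delta>) without a separate event. As \<open>0 ^ 0 = 1\<close>, the case s = 0 is the indicator
  of the state 0, and s = 1 that of not being \<Delta>.\<close>

definition killed_power :: "real \<Rightarrow> nat option \<Rightarrow> real" where
  "killed_power s x = (case x of None \<Rightarrow> 0 | Some k \<Rightarrow> s ^ k)"

lemma killed_power_simps [simp]:
  "killed_power s None = 0" "killed_power s (Some k) = s ^ k"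
  by (simp_all add: killed_power_def)

lemma killed_power_nonneg: "0 \<le> s \<Longrightarrow> 0 \<le> killed_power s x"
  and killed_power_le_1: "0 \<le> s \<Longrightarrow> s \<le> 1 \<Longrightarrow> killed_power s x \<le> 1"
  by (auto simp: killed_power_def power_le_one split: option.split)

lemma abs_killed_power_le_1: "0 \<le> s \<Longrightarrow> s \<le> 1 \<Longrightarrow> \<bar>killed_power s x\<bar> \<le> 1"
  by (simp add: killed_power_nonneg killed_power_le_1)

text \<open>A single factor 0 kills the product exactly as a single outcome \<Delta> kills the
  process; otherwise exponents add. This product form is what independence acts on.\<close>

lemma killed_power_total_offspring:
  "killed_power s (total_offspring x k) = (\<Prod>i<k. killed_power s (x i))"
proof (induction k)
  case (Suc k)
  then show ?case
    by (cases "total_offspring x k"; cases "x k") (simp_all add: total_offspring_Suc power_add flip: Suc)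
qed (simp add: total_offspring_0)

text \<open>The process as a deterministic function of the array of outcomes, which makes visible
  that generation n depends only on rows 1 to n.\<close>

primrec gw_path :: "(nat \<times> nat \<Rightarrow> nat option) \<Rightarrow> nat \<Rightarrow> nat option" where
  "gw_path x 0 = Some 1"
| "gw_path x (Suc n) = (case gw_path x n of None \<Rightarrow> None
     | Some k \<Rightarrow> total_offspring (\<lambda>i. x (Suc n, i)) k)"

text \<open>Only coordinates from rows 1 to n are read, so any index set \<open>K\<close> containing
  them will do. The random number of summands is handled by splitting over its countably many
  values.\<close>

lemma measurable_gw_path:
  "{1..n} \<times> UNIV \<subseteq> K \<Longrightarrow> (\<lambda>x. gw_path x n) \<in> PiM K (\<lambda>_. count_space UNIV) \<rightarrow>\<^sub>M count_space UNIV"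
proof (induction n)
  case (Suc n)
  have [measurable]: "(\<lambda>x. gw_path x n) \<in> PiM K (\<lambda>_. count_space UNIV) \<rightarrow>\<^sub>M count_space UNIV"
    using Suc by (auto simp: subset_iff)
  have [measurable]: "(\<lambda>x. total_offspring (\<lambda>i. x (Suc n, i)) k) \<in> PiM K (\<lambda>_. count_space UNIV) \<rightarrow>\<^sub>M count_space UNIV" for k
    using Suc.prems by (intro measurable_total_offspring measurable_component_singleton) auto
  have "(\<lambda>x. case y of None \<Rightarrow> None | Some k \<Rightarrow> total_offspring (\<lambda>i. x (Suc n, i)) k)
      \<in> PiM K (\<lambda>_. count_space UNIV) \<rightarrow>\<^sub>M count_space UNIV" for y
    by (cases y) simp_all
  then show ?case
    unfolding gw_path.simps by (rule measurable_compose_countable) measurable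
qed simp

section \<open>Conditioning on the previous generation\<close>

locale galton_watson = prob_space M for M :: "'w measure" +
  fixes \<xi> :: "nat \<Rightarrow> nat \<Rightarrow> 'w \<Rightarrow> nat option" and Z :: "nat \<Rightarrow> 'w \<Rightarrow> nat option"
  assumes indep: "indep_vars (\<lambda>_. count_space UNIV) (\<lambda>(n, i). \<xi> n i) ({1..} \<times> UNIV)"
    and Z_0: "\<omega> \<in> space M \<Longrightarrow> Z 0 \<omega> = Some 1"
    and Z_Suc: "\<omega> \<in> space M \<Longrightarrow> Z (Suc n) \<omega> =
      (case Z n \<omega> of None \<Rightarrow> None | Some k \<Rightarrow> total_offspring (\<lambda>i. \<xi> (Suc n) i \<omega>) k)"
begin

lemma offspring_measurable [measurable]: "\<xi> (Suc n) i \<in> M \<rightarrow>\<^sub>M count_space UNIV"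
  using indep by (force simp: indep_vars_def)

text \<open>\<open>restrict\<close> leaves the coordinates outside \<open>K\<close> undefined, but
  the first n generations never read them. The restricted form is the one in which independence of
  blocks is stated.\<close>

lemma Z_eq_gw_path:
  assumes \<omega>: "\<omega> \<in> space M" and K: "{1..n} \<times> UNIV \<subseteq> K"
  shows "Z n \<omega> = gw_path (restrict (\<lambda>(m, i). \<xi> m i \<omega>) K) n"
proof -
  define x where "x = restrict (\<lambda>(m, i). \<xi> m i \<omega>) K"
  have x: "x (m, i) = \<xi> m i \<omega>" if "1 \<le> m" "m \<le> n" for m i
  proof -
    have "(m, i) \<in> K"
      using that by (intro subsetD[OF K]) simp
    then show ?thesis by (simp add: x_def)
  qed
  have "m \<le> n \<Longrightarrow> Z m \<omega> = gw_path x m" for m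
    by (induction m) (simp_all add: Z_0[OF \<omega>] Z_Suc[OF \<omega>] x split: option.split)
  then show ?thesis by (simp add: x_def)
qed

lemma Z_measurable [measurable]: "Z n \<in> M \<rightarrow>\<^sub>M count_space UNIV"
proof (induction n)
  case 0
  then show ?case
    by (subst measurable_cong[of _ _ "\<lambda>_. Some 1"]) (simp_all add: Z_0)
next
  case (Suc n)
  note [measurable] = Suc
  have [measurable]: "(\<lambda>\<omega>. total_offspring (\<lambda>i. \<xi> (Suc n) i \<omega>) k) \<in> M \<rightarrow>\<^sub>M count_space UNIV" for k
    by (intro measurable_total_offspring) simp
  have "(\<lambda>\<omega>. case y of None \<Rightarrow> None | Some k \<Rightarrow> total_offspring (\<lambda>i. \<xi> (Suc n) i \<omega>) k)
      \<in> M \<rightarrow>\<^sub>M count_space UNIV" for y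
    by (cases y) simp_all
  then have "(\<lambda>\<omega>. case Z n \<omega> of None \<Rightarrow> None | Some k \<Rightarrow> total_offspring (\<lambda>i. \<xi> (Suc n) i \<omega>) k)
      \<in> M \<rightarrow>\<^sub>M count_space UNIV"
    by (rule measurable_compose_countable) measurable
  then show ?case
    by (subst measurable_cong[OF Z_Suc])
qed

text \<open>Independence is used twice: between generations, to split off the event that generation
  n has size k, and inside generation n + 1, to turn the product of k factors into
  \<open>m ^ k\<close>. A general \<open>h\<close> covers both killed powers and the indicator of
  having exactly one child.\<close>

lemma expectation_fibre_prod_offspring:
  fixes h :: "nat option \<Rightarrow> real"
  assumes h: "\<And>x. \<bar>h x\<bar> \<le> 1" and m: "\<And>i. expectation (\<lambda>\<omega>. h (\<xi> (Suc n) i \<omega>)) = m"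
  shows "expectation (\<lambda>\<omega>. indicator {Some k} (Z n \<omega>) * (\<Prod>i<k. h (\<xi> (Suc n) i \<omega>))) =
    expectation (\<lambda>\<omega>. indicator {Some k} (Z n \<omega>)) * m ^ k"
proof -
  let ?A = "{1..n} \<times> (UNIV :: nat set)" and ?B = "{Suc n} \<times> (UNIV :: nat set)"
  let ?X = "\<lambda>\<omega> (m, i). \<xi> m i \<omega>"
  let ?Y1 = "\<lambda>x. indicator {Some k} (gw_path x n) :: real"
  let ?Y2 = "\<lambda>x. \<Prod>i<k. h (x (Suc n, i))"
  let ?U = "\<lambda>\<omega>. ?Y1 (restrict (?X \<omega>) ?A)" and ?V = "\<lambda>\<omega>. ?Y2 (restrict (?X \<omega>) ?B)"
  have X: "(\<lambda>(n, i). \<xi> n i) = (\<lambda>i \<omega>. ?X \<omega> i)"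
    by (auto simp: fun_eq_iff)
  \<comment> \<open>The index blocks are disjoint: generations 1 to n against generation n +
    1.\<close>
  have ind: "indep_var (PiM ?A (\<lambda>_. count_space UNIV)) (\<lambda>\<omega>. restrict (?X \<omega>) ?A)
      (PiM ?B (\<lambda>_. count_space UNIV)) (\<lambda>\<omega>. restrict (?X \<omega>) ?B)"
    using indep[unfolded X] by (rule indep_var_restrict) auto
  have [measurable]: "(\<lambda>x. gw_path x n) \<in> PiM ?A (\<lambda>_. count_space UNIV) \<rightarrow>\<^sub>M count_space UNIV"
    by (rule measurable_gw_path) simp
  have "indep_var borel (?Y1 \<circ> (\<lambda>\<omega>. restrict (?X \<omega>) ?A)) borel (?Y2 \<circ> (\<lambda>\<omega>. restrict (?X \<omega>) ?B))"
  proof (rule indep_var_compose[OF ind])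
    show "?Y1 \<in> borel_measurable (PiM ?A (\<lambda>_. count_space UNIV))"
      by measurable
    show "?Y2 \<in> borel_measurable (PiM ?B (\<lambda>_. count_space UNIV))"
      by (intro borel_measurable_prod measurable_compose[OF measurable_component_singleton]) auto
  qed
  then have UV: "indep_var borel ?U borel ?V"
    by (simp add: comp_def)
  have U: "?U \<omega> = indicator {Some k} (Z n \<omega>)" if "\<omega> \<in> space M" for \<omega>
    using Z_eq_gw_path[OF that, of n ?A] by simp
  have V: "?V \<omega> = (\<Prod>i<k. h (\<xi> (Suc n) i \<omega>))" for \<omega>
    by simp
  have [measurable]: "h \<in> borel_measurable (count_space UNIV)"
    by simp
  have prod_le: "\<bar>\<Prod>i<k. h (\<xi> (Suc n) i \<omega>)\<bar> \<le> 1" for \<omega>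
    unfolding abs_prod by (intro prod_le_1) (auto simp: h)
  have "integrable M (\<lambda>\<omega>. indicator {Some k} (Z n \<omega>) :: real)"
    by (intro integrable_const_bound[of _ 1]) (auto simp: indicator_def)
  then have intU: "integrable M ?U"
    using U by (subst Bochner_Integration.integrable_cong[OF refl U]) auto
  have intV: "integrable M (\<lambda>\<omega>. \<Prod>i<k. h (\<xi> (Suc n) i \<omega>))"
    by (intro integrable_const_bound[of _ 1]) (auto simp: prod_le)
  have "expectation (\<lambda>\<omega>. indicator {Some k} (Z n \<omega>) * (\<Prod>i<k. h (\<xi> (Suc n) i \<omega>))) =
      expectation (\<lambda>\<omega>. ?U \<omega> * ?V \<omega>)"
    by (intro Bochner_Integration.integral_cong) (simp_all only: U V)
  also have "\<dots> = expectation ?U * expectation ?V"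
    using UV intU intV unfolding V[symmetric] by (rule indep_var_lebesgue_integral)
  also have "expectation ?U = expectation (\<lambda>\<omega>. indicator {Some k} (Z n \<omega>))"
    by (intro Bochner_Integration.integral_cong) (simp_all only: U)
  also have "expectation ?V = (\<Prod>i<k. expectation (\<lambda>\<omega>. h (\<xi> (Suc n) i \<omega>)))"
  proof -
    \<comment> \<open>The k individuals as indices of the doubly indexed independent family.\<close>
    let ?J = "Pair (Suc n) ` {..<k}"
    have J: "inj_on (Pair (Suc n)) {..<k}"
      by (simp add: inj_on_def)
    have "expectation ?V = expectation (\<lambda>\<omega>. \<Prod>j\<in>?J. h ((case j of (n, i) \<Rightarrow> \<xi> n i) \<omega>))"
      by (simp add: prod.reindex[OF J])
    also have "\<dots> = (\<Prod>j\<in>?J. expectation (\<lambda>\<omega>. h ((case j of (n, i) \<Rightarrow> \<xi> n i) \<omega>)))"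
    proof (rule indep_vars_lebesgue_integral)
      have "indep_vars (\<lambda>_. count_space UNIV) (\<lambda>(n, i). \<xi> n i) ?J"
        by (rule indep_vars_subset[OF indep]) auto
      then show "indep_vars (\<lambda>_. borel) (\<lambda>j \<omega>. h ((case j of (n, i) \<Rightarrow> \<xi> n i) \<omega>)) ?J"
        by (rule indep_vars_compose2) simp
      show "integrable M (\<lambda>\<omega>. h ((case j of (n, i) \<Rightarrow> \<xi> n i) \<omega>))" if "j \<in> ?J" for j
        using that by (intro integrable_const_bound[of _ 1]) (auto simp: h)
    qed simp
    finally show ?thesis
      by (simp add: prod.reindex[OF J])
  qed
  finally show ?thesis
    by (simp add: m)
qed

lemma killed_power_Z_integrable:
  "0 \<le> s \<Longrightarrow> s \<le> 1 \<Longrightarrow> integrable M (\<lambda>\<omega>. killed_power s (Z n \<omega>))"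
  by (intro integrable_const_bound[of _ 1]) (auto simp: abs_killed_power_le_1)

text \<open>Collects the previous identity over all sizes k; both integrands vanish at \<Delta>. The
  range of \<open>m\<close> keeps \<open>killed_power m\<close> bounded and hence
  integrable.\<close>

lemma expectation_prod_offspring:
  fixes h :: "nat option \<Rightarrow> real"
  assumes h: "\<And>x. \<bar>h x\<bar> \<le> 1" and m: "\<And>i. expectation (\<lambda>\<omega>. h (\<xi> (Suc n) i \<omega>)) = m"
    and m01: "0 \<le> m" "m \<le> 1"
  defines "H \<equiv> \<lambda>\<omega>. case Z n \<omega> of None \<Rightarrow> 0 | Some k \<Rightarrow> \<Prod>i<k. h (\<xi> (Suc n) i \<omega>)"
  shows "integrable M H" and "expectation H = expectation (\<lambda>\<omega>. killed_power m (Z n \<omega>))"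
proof -
  have [measurable]: "h \<in> borel_measurable (count_space UNIV)"
    by simp
  have "(\<lambda>\<omega>. case y of None \<Rightarrow> 0 | Some k \<Rightarrow> \<Prod>i<k. h (\<xi> (Suc n) i \<omega>)) \<in> borel_measurable M" for y
    by (cases y) simp_all
  then have H [measurable]: "H \<in> borel_measurable M"
    unfolding H_def by (rule measurable_compose_countable) measurable
  have "\<bar>\<Prod>i<k. h (\<xi> (Suc n) i \<omega>)\<bar> \<le> 1" for k \<omega>
    unfolding abs_prod by (intro prod_le_1) (auto simp: h)
  then show int: "integrable M H"
    by (intro integrable_const_bound[of _ 1]) (use H in \<open>auto simp: H_def split: option.split\<close>)
  show "expectation H = expectation (\<lambda>\<omega>. killed_power m (Z n \<omega>))"
  proof (rule integral_eqI_countable_fibres[OF Z_measurable int killed_power_Z_integrable[OF m01]])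
    fix y
    show "expectation (\<lambda>\<omega>. indicator {y} (Z n \<omega>) * H \<omega>) =
      expectation (\<lambda>\<omega>. indicator {y} (Z n \<omega>) * killed_power m (Z n \<omega>))"
    proof (cases y)
      case None
      then have "indicator {y} (Z n \<omega>) * H \<omega> = indicator {y} (Z n \<omega>) * killed_power m (Z n \<omega>)" for \<omega>
        by (cases "Z n \<omega>") (simp_all add: H_def)
      then show ?thesis by presburger
    next
      case (Some k)
      have "indicator {y} (Z n \<omega>) * H \<omega> =
          indicator {Some k} (Z n \<omega>) * (\<Prod>i<k. h (\<xi> (Suc n) i \<omega>))"
        "indicator {y} (Z n \<omega>) * killed_power m (Z n \<omega>) = indicator {Some k} (Z n \<omega>) * m ^ k" for \<omega>
        by (auto simp: H_def Some indicator_def)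
      then show ?thesis
        using expectation_fibre_prod_offspring[OF h m] by simp
    qed
  qed
qed

text \<open>The branching property: the killed power of a total offspring is a product over
  individuals, and \<open>m\<close> plays the part of f_(n+1)(s).\<close>

lemma expectation_killed_power_Suc:
  assumes s: "0 \<le> s" "s \<le> 1" and m: "\<And>i. expectation (\<lambda>\<omega>. killed_power s (\<xi> (Suc n) i \<omega>)) = m"
    and m01: "0 \<le> m" "m \<le> 1"
  shows "expectation (\<lambda>\<omega>. killed_power s (Z (Suc n) \<omega>)) = expectation (\<lambda>\<omega>. killed_power m (Z n \<omega>))"
proof -
  have "expectation (\<lambda>\<omega>. killed_power s (Z (Suc n) \<omega>)) =
    expectation (\<lambda>\<omega>. case Z n \<omega> of None \<Rightarrow> 0 | Some k \<Rightarrow> \<Prod>i<k. killed_power s (\<xi> (Suc n) i \<omega>))"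
    by (intro Bochner_Integration.integral_cong)
       (auto simp: Z_Suc killed_power_total_offspring split: option.split)
  also have "\<dots> = expectation (\<lambda>\<omega>. killed_power m (Z n \<omega>))"
    using s m m01 by (intro expectation_prod_offspring) (auto simp: abs_killed_power_le_1)
  finally show ?thesis .
qed

section \<open>Absorbing states, their probabilities and the mean\<close>

lemma absorbing_None: "\<omega> \<in> space M \<Longrightarrow> Z n \<omega> = None \<Longrightarrow> Z (Suc n) \<omega> = None"
  and absorbing_0: "\<omega> \<in> space M \<Longrightarrow> Z n \<omega> = Some 0 \<Longrightarrow> Z (Suc n) \<omega> = Some 0"
  by (simp_all add: Z_Suc total_offspring_0)

lemma prob_Z_neq_None: "prob {\<omega> \<in> space M. Z n \<omega> \<noteq> None} = expectation (\<lambda>\<omega>. killed_power 1 (Z n \<omega>))"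
proof -
  have "killed_power 1 (Z n \<omega>) = indicator {\<omega> \<in> space M. Z n \<omega> \<noteq> None} \<omega>" if "\<omega> \<in> space M" for \<omega>
    using that by (auto simp: indicator_def)
  then have "expectation (\<lambda>\<omega>. killed_power 1 (Z n \<omega>)) = expectation (indicator {\<omega> \<in> space M. Z n \<omega> \<noteq> None})"
    by (intro Bochner_Integration.integral_cong) auto
  then show ?thesis by simp
qed

lemma prob_Z_eq_0: "prob {\<omega> \<in> space M. Z n \<omega> = Some 0} = expectation (\<lambda>\<omega>. killed_power 0 (Z n \<omega>))"
proof -
  have "killed_power 0 (Z n \<omega>) = indicator {\<omega> \<in> space M. Z n \<omega> = Some 0} \<omega>" if "\<omega> \<in> space M" for \<omega>
    using that by (cases "Z n \<omega>") (auto simp: indicator_def)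
  then have "expectation (\<lambda>\<omega>. killed_power 0 (Z n \<omega>)) = expectation (indicator {\<omega> \<in> space M. Z n \<omega> = Some 0})"
    by (intro Bochner_Integration.integral_cong) auto
  then show ?thesis by simp
qed

text \<open>The mean is the increasing limit of \<open>(F 1 - F s) / (1 - s)\<close> as \<open>s\<close> increases to \<open>1\<close>.\<close>

lemma expectation_Z_eq_deriv:
  assumes F: "\<And>s. s \<in> {0..1} \<Longrightarrow> expectation (\<lambda>\<omega>. killed_power s (Z n \<omega>)) = F s"
    and deriv: "(F has_real_derivative F') (at 1 within {0..1})"
  defines "m \<equiv> \<lambda>x. case x of None \<Rightarrow> 0 | Some k \<Rightarrow> real k"
  shows "integrable M (\<lambda>\<omega>. m (Z n \<omega>))" and "expectation (\<lambda>\<omega>. m (Z n \<omega>)) = F'"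
proof -
  \<comment> \<open>Starts at 0 and increases to 1 without reaching it, so the difference quotients
    below are well defined.\<close>
  define t where "t i = 1 - inverse (real (Suc i))" for i
  have t: "0 \<le> t i" "t i < 1" "t i \<le> t (Suc i)" for i
    by (auto simp: t_def field_simps)
  have mono_t: "t i \<le> t j" if "i \<le> j" for i j
    using t(3) that by (rule lift_Suc_mono_le)
  have t_lim: "t \<longlonglongrightarrow> 1"
    unfolding t_def using tendsto_diff[OF tendsto_const LIMSEQ_inverse_real_of_nat, of 1] by simp
  define u where "u i x = (killed_power 1 x - killed_power (t i) x) / (1 - t i)" for i x
  \<comment> \<open>The quotient (1 - t^k) / (1 - t) is the geometric sum 1 + t + ... + t^(k-1):
    nonnegative, increasing in t, with limit k.\<close>
  have u: "u i x = (case x of None \<Rightarrow> 0 | Some k \<Rightarrow> \<Sum>j<k. t i ^ j)" for i x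
    using t(2)[of i] by (auto simp: u_def sum_gp_strict split: option.split)
  have int_u: "integrable M (\<lambda>\<omega>. u i (Z n \<omega>))" for i
    unfolding u_def using t[of i]
    by (intro integrable_divide_zero Bochner_Integration.integrable_diff killed_power_Z_integrable) auto
  have mono_u: "mono (\<lambda>i. u i x)" for x
    using mono_t t by (auto simp: u mono_def intro!: sum_mono power_mono split: option.split)
  have nonneg_u: "0 \<le> u i x" for i x
    using t by (auto simp: u intro!: sum_nonneg split: option.split)
  have lim_u: "(\<lambda>i. u i x) \<longlonglongrightarrow> m x" for x
  proof (cases x)
    case (Some k)
    have "(\<lambda>i. \<Sum>j<k. t i ^ j) \<longlonglongrightarrow> (\<Sum>j<k. 1 ^ j)"
      by (intro tendsto_intros t_lim)
    then show ?thesis by (simp add: u m_def Some)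
  qed (simp add: u m_def)
  have "((\<lambda>y. (F y - F 1) / (y - 1)) \<longlongrightarrow> F') (at 1 within {0..1})"
    using deriv by (simp add: has_field_derivative_iff)
  moreover have "filterlim t (at 1 within {0..1}) sequentially"
    using t t_lim by (auto simp: filterlim_at intro!: always_eventually order.strict_implies_order less_imp_neq)
  ultimately have "(\<lambda>i. (F (t i) - F 1) / (t i - 1)) \<longlonglongrightarrow> F'"
    by (rule filterlim_compose)
  moreover have "expectation (\<lambda>\<omega>. u i (Z n \<omega>)) = (F (t i) - F 1) / (t i - 1)" for i
  proof -
    have "expectation (\<lambda>\<omega>. u i (Z n \<omega>)) = (F 1 - F (t i)) / (1 - t i)"
      using t[of i] F[of 1] F[of "t i"] unfolding u_def
      by (simp add: Bochner_Integration.integral_diff killed_power_Z_integrable less_imp_le)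
    also have "\<dots> = (F (t i) - F 1) / (t i - 1)"
      by (metis minus_diff_eq minus_divide_divide)
    finally show ?thesis .
  qed
  ultimately have "(\<lambda>i. expectation (\<lambda>\<omega>. u i (Z n \<omega>))) \<longlonglongrightarrow> F'"
    by simp
  \<comment> \<open>Monotone convergence takes the finite limit of the expectations as input and
    returns both the integrability of the limit and its mean.\<close>
  note mono_conv = integral_monotone_convergence_nonneg[OF int_u _ _ _ this]
  show "integrable M (\<lambda>\<omega>. m (Z n \<omega>))"
    by (rule mono_conv(1)) (use mono_u nonneg_u lim_u in auto)
  show "expectation (\<lambda>\<omega>. m (Z n \<omega>)) = F'"
    by (rule mono_conv(2)) (use mono_u nonneg_u lim_u in auto)
qed


section \<open>Almost sure stabilization\<close>

text \<open>If every individual has exactly one child, the size stays the same. Hence a change has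
  probability at most E(1 - p^(Z_n); Z_n \<noteq> \<Delta>), and Bernoulli's inequality 1 - p^k
  \<le> k (1 - p) brings in the mean.\<close>

lemma prob_Z_change_le:
  assumes p: "\<And>i. prob {\<omega> \<in> space M. \<xi> (Suc n) i \<omega> = Some 1} = p"
  defines "m \<equiv> \<lambda>x. case x of None \<Rightarrow> 0 | Some k \<Rightarrow> real k"
  assumes int: "integrable M (\<lambda>\<omega>. m (Z n \<omega>))"
  shows "prob {\<omega> \<in> space M. Z (Suc n) \<omega> \<noteq> Z n \<omega>} \<le> (1 - p) * expectation (\<lambda>\<omega>. m (Z n \<omega>))"
proof -
  let ?C = "{\<omega> \<in> space M. Z (Suc n) \<omega> \<noteq> Z n \<omega>}"
  define h :: "nat option \<Rightarrow> real" where "h = indicator {Some 1}"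
  \<comment> \<open>The indicator that generation n is not \<Delta> and all its individuals have
    exactly one child; for size 0 the empty product gives 1.\<close>
  define H where "H \<omega> = (case Z n \<omega> of None \<Rightarrow> 0 | Some k \<Rightarrow> \<Prod>i<k. h (\<xi> (Suc n) i \<omega>))" for \<omega>
  have p01: "0 \<le> p" "p \<le> 1"
    using p[of 0] by (auto simp flip: p[of 0])
  have Eh: "expectation (\<lambda>\<omega>. h (\<xi> (Suc n) i \<omega>)) = p" for i
  proof -
    have "expectation (\<lambda>\<omega>. h (\<xi> (Suc n) i \<omega>)) = expectation (indicator {\<omega> \<in> space M. \<xi> (Suc n) i \<omega> = Some 1})"
      by (intro Bochner_Integration.integral_cong) (auto simp: h_def indicator_def)
    then show ?thesis using p by simp
  qed
  have h1: "\<bar>h x\<bar> \<le> 1" for x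
    by (simp add: h_def indicator_def)
  note H = expectation_prod_offspring[OF h1 Eh p01, folded H_def]
  have C [measurable]: "?C \<in> events"
    by measurable
  have stay: "indicator ?C \<omega> \<le> killed_power 1 (Z n \<omega>) - H \<omega>" if \<omega>: "\<omega> \<in> space M" for \<omega>
  proof (cases "Z n \<omega>")
    case None
    then show ?thesis
      using \<omega> by (simp add: H_def Z_Suc indicator_def)
  next
    case (Some k)
    show ?thesis
    proof (cases "\<forall>i<k. \<xi> (Suc n) i \<omega> = Some 1")
      case True
      then have "Z (Suc n) \<omega> = Z n \<omega>"
        using \<omega> by (simp add: Z_Suc Some total_offspring_def)
      then show ?thesis
        using True by (simp add: Some H_def h_def)
    next
      case False
      then have "H \<omega> = 0"
        by (auto simp: H_def Some h_def indicator_def)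
      then show ?thesis
        by (simp add: Some indicator_def)
    qed
  qed
  have mean: "killed_power 1 x - killed_power p x \<le> (1 - p) * m x" for x
  proof (cases x)
    case (Some k)
    show ?thesis
      using Bernoulli_inequality[of "p - 1" k] p01 by (simp add: Some m_def algebra_simps)
  qed (simp add: m_def)
  have "prob ?C = expectation (indicator ?C)"
    by simp
  also have "\<dots> \<le> expectation (\<lambda>\<omega>. killed_power 1 (Z n \<omega>) - H \<omega>)"
    using H(1) killed_power_Z_integrable stay integrable_real_indicator[OF C]
    by (intro integral_mono) (auto simp: emeasure_eq_measure)
  also have "\<dots> = expectation (\<lambda>\<omega>. killed_power 1 (Z n \<omega>) - killed_power p (Z n \<omega>))"
    using H killed_power_Z_integrable p01 by simp
  also have "\<dots> \<le> expectation (\<lambda>\<omega>. (1 - p) * m (Z n \<omega>))"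
    using killed_power_Z_integrable p01 int mean by (intro integral_mono) auto
  finally show ?thesis by simp
qed

text \<open>The value \<open>None\<close> stands for two cases: ending in \<Delta>, and not
  stabilizing at all. Summable change probabilities make the second case a null event.\<close>

definition Z_limit :: "'w \<Rightarrow> nat option" where
  "Z_limit \<omega> = (if \<exists>k. \<forall>\<^sub>F n in sequentially. Z n \<omega> = Some k
     then Some (THE k. \<forall>\<^sub>F n in sequentially. Z n \<omega> = Some k) else None)"

lemma Z_limit_eq_Some_iff: "Z_limit \<omega> = Some k \<longleftrightarrow> (\<forall>\<^sub>F n in sequentially. Z n \<omega> = Some k)"
proof -
  have uniq: "j = k" if "\<forall>\<^sub>F n in sequentially. Z n \<omega> = Some j" "\<forall>\<^sub>F n in sequentially. Z n \<omega> = Some k" for j k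
    using eventually_happens'[OF sequentially_bot eventually_conj[OF that]] by auto
  then have "(THE k. \<forall>\<^sub>F n in sequentially. Z n \<omega> = Some k) = k" if "\<forall>\<^sub>F n in sequentially. Z n \<omega> = Some k" for k
    using that by blast
  then show ?thesis
    by (auto simp: Z_limit_def)
qed

text \<open>Each event \<open>Z_limit = Some k\<close> is a countable union of countable
  intersections, \<open>None\<close> is the complement of all of these, and singletons suffice on a
  countable space.\<close>

lemma Z_limit_measurable [measurable]: "Z_limit \<in> M \<rightarrow>\<^sub>M count_space UNIV"
proof -
  have *: "{\<omega> \<in> space M. Z_limit \<omega> = Some k} \<in> events" for k
    unfolding Z_limit_eq_Some_iff eventually_sequentially by measurable
  moreover have "{\<omega> \<in> space M. Z_limit \<omega> = None} = space M - (\<Union>k. {\<omega> \<in> space M. Z_limit \<omega> = Some k})"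
    by auto
  ultimately have "{\<omega> \<in> space M. Z_limit \<omega> = x} \<in> events" for x
    by (cases x) (auto intro!: sets.Diff)
  then have "Z_limit -` {x} \<inter> space M \<in> events" for x
    by (simp add: vimage_def Int_def conj_commute)
  then show ?thesis
    by (auto simp: measurable_count_space_eq2_countable)
qed

text \<open>By the first Borel-Cantelli lemma there are almost surely finitely many changes. The
  final value is then \<open>Z_limit\<close>; if it is \<open>None\<close>, no other value can be
  eventual.\<close>

lemma AE_eventually_eq_Z_limit:
  assumes "summable (\<lambda>n. prob {\<omega> \<in> space M. Z (Suc n) \<omega> \<noteq> Z n \<omega>})"
  shows "AE \<omega> in M. \<forall>\<^sub>F n in sequentially. Z n \<omega> = Z_limit \<omega>"
proof -
  have "AE \<omega> in M. \<forall>\<^sub>F n in sequentially. \<omega> \<in> space M - {\<omega> \<in> space M. Z (Suc n) \<omega> \<noteq> Z n \<omega>}"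
    using assms by (intro borel_cantelli_AE1) (auto simp: emeasure_eq_measure)
  then show ?thesis
  proof eventually_elim
    case (elim \<omega>)
    then obtain N where N: "\<And>n. n \<ge> N \<Longrightarrow> Z (Suc n) \<omega> = Z n \<omega>"
      by (auto simp: eventually_sequentially)
    have eq: "Z n \<omega> = Z N \<omega>" if "n \<ge> N" for n
      using that by (induction n rule: dec_induct) (simp_all add: N)
    then have ev: "\<forall>\<^sub>F n in sequentially. Z n \<omega> = Z N \<omega>"
      by (rule eventually_sequentiallyI)
    have "Z_limit \<omega> = Z N \<omega>"
    proof (cases "Z N \<omega>")
      case None
      have "Z_limit \<omega> \<noteq> Some k" for k
      proof
        assume "Z_limit \<omega> = Some k"
        then have "\<forall>\<^sub>F n in sequentially. Z n \<omega> = Some k"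
          by (simp add: Z_limit_eq_Some_iff)
        from eventually_happens'[OF sequentially_bot eventually_conj[OF ev this]]
        show False using None by auto
      qed
      then show ?thesis using None by auto
    next
      case (Some k)
      then show ?thesis
        using ev by (simp add: Z_limit_eq_Some_iff)
    qed
    then show ?case using ev by simp
  qed
qed

text \<open>The integrands are almost surely eventually constant and bounded by 1, so dominated
  convergence applies, also at s = 0 and s = 1.\<close>

lemma expectation_killed_power_tendsto_Z_limit:
  assumes conv: "AE \<omega> in M. \<forall>\<^sub>F n in sequentially. Z n \<omega> = Z_limit \<omega>" and s: "0 \<le> s" "s \<le> 1"
  shows "(\<lambda>n. expectation (\<lambda>\<omega>. killed_power s (Z n \<omega>)))
    \<longlonglongrightarrow> expectation (\<lambda>\<omega>. killed_power s (Z_limit \<omega>))"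
proof (rule integral_dominated_convergence[where w = "\<lambda>_. 1"])
  show "AE \<omega> in M. (\<lambda>n. killed_power s (Z n \<omega>)) \<longlonglongrightarrow> killed_power s (Z_limit \<omega>)"
    using conv
  proof eventually_elim
    case (elim \<omega>)
    then show ?case
      by (intro tendsto_eventually) (auto elim: eventually_mono)
  qed
qed (use s in \<open>auto simp: abs_killed_power_le_1\<close>)

end

section \<open>Absorption times\<close>

lemma enat_less_absorption_time_iff:
  assumes "\<And>m. Z m \<omega> = x \<Longrightarrow> Z (Suc m) \<omega> = x"
  shows "enat n < absorption_time Z x \<omega> \<longleftrightarrow> Z n \<omega> \<noteq> x"
proof
  assume "enat n < absorption_time Z x \<omega>"
  then show "Z n \<omega> \<noteq> x"
    unfolding absorption_time_def by (metis (mono_tags, lifting) Inf_lower leD mem_Collect_eq)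
next
  assume n: "Z n \<omega> \<noteq> x"
  \<comment> \<open>Writing the strict inequality as a lower bound n + 1 of the infimum also covers
    the empty set of times.\<close>
  have "enat (Suc n) \<le> absorption_time Z x \<omega>"
    unfolding absorption_time_def
  proof (rule Inf_greatest, clarify)
    fix m assume m: "x = Z m \<omega>"
    have "m > n"
    proof (rule ccontr)
      assume "\<not> m > n"
      then have "m \<le> n" by simp
      then have "Z n \<omega> = x"
        by (induction n rule: dec_induct) (simp_all add: m[symmetric] assms)
      with n show False by simp
    qed
    then show "enat (Suc n) \<le> enat m" by simp
  qed
  then show "enat n < absorption_time Z x \<omega>"
    by (simp add: Suc_ile_eq)
qed

lemma absorption_time_finite_iff: "absorption_time Z x \<omega> < \<infinity> \<longleftrightarrow> (\<exists>n. Z n \<omega> = x)"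
proof
  assume fin: "absorption_time Z x \<omega> < \<infinity>"
  show "\<exists>n. Z n \<omega> = x"
  proof (rule ccontr)
    assume "\<nexists>n. Z n \<omega> = x"
    then have "absorption_time Z x \<omega> = \<infinity>"
      by (simp add: absorption_time_def Inf_enat_def)
    with fin show False by simp
  qed
next
  assume "\<exists>n. Z n \<omega> = x"
  then obtain n where "Z n \<omega> = x" ..
  then have "absorption_time Z x \<omega> \<le> enat n"
    unfolding absorption_time_def by (intro Inf_lower) auto
  then show "absorption_time Z x \<omega> < \<infinity>"
    by (rule order_le_less_trans) simp
qed

text \<open>Absorption makes the events increase with n, and their union is the event of a finite
  absorption time.\<close>

lemma (in galton_watson) prob_tendsto_absorption:
  assumes abs: "\<And>n \<omega>. \<omega> \<in> space M \<Longrightarrow> Z n \<omega> = x \<Longrightarrow> Z (Suc n) \<omega> = x"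
  shows "(\<lambda>n. prob {\<omega> \<in> space M. Z n \<omega> = x}) \<longlonglongrightarrow> \<P>(\<omega> in M. absorption_time Z x \<omega> < \<infinity>)"
proof -
  have "incseq (\<lambda>n. {\<omega> \<in> space M. Z n \<omega> = x})"
    by (rule incseq_SucI) (use abs in auto)
  then have "(\<lambda>n. prob {\<omega> \<in> space M. Z n \<omega> = x}) \<longlonglongrightarrow> prob (\<Union>n. {\<omega> \<in> space M. Z n \<omega> = x})"
    by (intro finite_Lim_measure_incseq) auto
  also have "(\<Union>n. {\<omega> \<in> space M. Z n \<omega> = x}) = {\<omega> \<in> space M. absorption_time Z x \<omega> < \<infinity>}"
    unfolding absorption_time_finite_iff by auto
  finally show ?thesis .
qed

lemma (in galton_watson) prob_absorbed:
  "\<P>(\<omega> in M. min (absorption_time Z (Some 0) \<omega>) (absorption_time Z None \<omega>) < \<infinity>) =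
   \<P>(\<omega> in M. absorption_time Z (Some 0) \<omega> < \<infinity>) + \<P>(\<omega> in M. absorption_time Z None \<omega> < \<infinity>)"
proof -
  let ?T = "\<lambda>x. {\<omega> \<in> space M. absorption_time Z x \<omega> < \<infinity>}"
  have [measurable]: "?T x \<in> events" for x
    unfolding absorption_time_finite_iff by measurable
  have disj: "?T (Some 0) \<inter> ?T None = {}"
  proof -
    have False if \<omega>: "\<omega> \<in> space M" and mn: "Z m \<omega> = Some 0" "Z n \<omega> = None" for \<omega> m n
    proof -
      \<comment> \<open>A path visiting both absorbing states would be in both at time m +
        n.\<close>
      have "Z (m + n) \<omega> = Some 0"
        by (induction n) (simp_all add: mn absorbing_0[OF \<omega>])
      moreover have "Z (m + n) \<omega> = None"
        by (induction m) (simp_all add: mn absorbing_None[OF \<omega>])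
      ultimately show False by simp
    qed
    then show ?thesis
      unfolding absorption_time_finite_iff by blast
  qed
  have "prob (?T (Some 0) \<union> ?T None) = prob (?T (Some 0)) + prob (?T None)"
    by (rule finite_measure_Union[OF _ _ disj]) measurable
  moreover have "{\<omega> \<in> space M. min (absorption_time Z (Some 0) \<omega>) (absorption_time Z None \<omega>) < \<infinity>} = ?T (Some 0) \<union> ?T None"
    unfolding min_less_iff_disj by blast
  ultimately show ?thesis
    by presburger
qed

section \<open>The theta = 0 generating functions\<close>

text \<open>With nonnegative coefficients the terms of degree at least 2 sum to at most s^2 f(1), so
  the difference quotient at 0 is at most p_1 + s f(1); let s tend to 0.\<close>

lemma coeff_1_ge_deriv:
  fixes p :: "nat \<Rightarrow> real"
  assumes p: "\<And>j. 0 \<le> p j"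
    and f: "\<And>s. s \<in> {0..1} \<Longrightarrow> (\<lambda>j. p j * s ^ j) sums f s"
    and deriv: "(f has_real_derivative f') (at 0 within {0..1})"
  shows "f' \<le> p 1"
proof -
  have bound: "(f s - f 0) / (s - 0) \<le> p 1 + s * f 1" if s: "0 < s" "s \<le> 1" for s
  proof -
    have f0: "f 0 = p 0"
      using sums_unique2[OF f[of 0] powser_sums_zero] by simp
    have 1: "(\<lambda>j. p (j + 2) * s ^ (j + 2)) sums (f s - (\<Sum>i<2. p i * s ^ i))"
      using s by (subst sums_iff_shift) (auto intro: f)
    have "(\<lambda>j. p (j + 2)) sums (f 1 - (\<Sum>i<2. p i))"
      using f[of 1] by (subst sums_iff_shift) simp
    then have 2: "(\<lambda>j. s\<^sup>2 * p (j + 2)) sums (s\<^sup>2 * (f 1 - (\<Sum>i<2. p i)))"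
      by (rule sums_mult)
    have "f s - (\<Sum>i<2. p i * s ^ i) \<le> s\<^sup>2 * (f 1 - (\<Sum>i<2. p i))"
    proof (rule sums_le[OF _ 1 2])
      fix j
      have "s ^ j * (p (j + 2) * s\<^sup>2) \<le> 1 * (p (j + 2) * s\<^sup>2)"
        using s p by (intro mult_right_mono power_le_one) auto
      then show "p (j + 2) * s ^ (j + 2) \<le> s\<^sup>2 * p (j + 2)"
        by (simp add: power2_eq_square mult_ac)
    qed
    also have "\<dots> \<le> s\<^sup>2 * f 1"
      using p by (intro mult_left_mono) (auto simp: sum_nonneg)
    finally have "f s - f 0 \<le> s * (p 1 + s * f 1)"
      by (simp add: numeral_2_eq_2 f0 algebra_simps)
    then show ?thesis
      using s by (simp add: divide_le_eq mult.commute)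
  qed
  have "((\<lambda>s. (f s - f 0) / (s - 0)) \<longlongrightarrow> f') (at 0 within {0..1})"
    using deriv by (simp add: has_field_derivative_iff)
  moreover have "((\<lambda>s. p 1 + s * f 1) \<longlongrightarrow> p 1 + 0 * f 1) (at 0 within {0..1})"
    by (intro tendsto_intros)
  moreover have "\<forall>\<^sub>F s in at 0 within {0..1}. (f s - f 0) / (s - 0) \<le> p 1 + s * f 1"
    using bound by (auto simp: eventually_at_filter less_le)
  moreover have "at (0::real) within {0..1} \<noteq> bot"
    by (simp add: at_within_Icc_at_right)
  ultimately show ?thesis
    using tendsto_le by force
qed

lemma theta0_pgf_deriv_0:
  assumes "r > 0"
  shows "(theta0_pgf r a c has_real_derivative (r - c) powr (1 - a) * (a * r powr (a - 1))) (at 0 within S)"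
  unfolding theta0_pgf_def
  by (rule derivative_eq_intros refl | use assms in simp)+

text \<open>As c \<le> 1, f'(0) is at least a ((r - 1) / r)^(1 - a) = a exp(- (1 - a) l) with l = ln
  (r / (r - 1)); then exp x \<ge> 1 + x and a \<le> 1 apply. The constant 1 + l depends on r only,
  hence serves all generations.\<close>

lemma theta0_pgf_deriv_0_ge:
  fixes r a c :: real
  assumes r: "r > 1" and a: "0 < a" "a < 1" and c: "0 \<le> c" "c \<le> 1"
  shows "1 - (r - c) powr (1 - a) * (a * r powr (a - 1)) \<le> (1 + ln (r / (r - 1))) * (1 - a)"
proof -
  let ?l = "ln (r / (r - 1))"
  have l: "0 \<le> ?l"
    using r by simp
  have "a - ?l * (1 - a) \<le> a * (1 + (1 - a) * (- ?l))"
  proof -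
    have "a * ((1 - a) * ?l) \<le> 1 * ((1 - a) * ?l)"
      using a l by (intro mult_right_mono) auto
    then show ?thesis by (simp add: algebra_simps)
  qed
  also have "\<dots> \<le> a * exp ((1 - a) * (- ?l))"
    using a by (intro mult_left_mono exp_ge_add_one_self) auto
  also have "\<dots> = a * ((r - 1) powr (1 - a) * r powr (a - 1))"
    using r by (simp add: powr_def ln_div algebra_simps flip: exp_add)
  also have "\<dots> \<le> a * ((r - c) powr (1 - a) * r powr (a - 1))"
    using a c r by (intro mult_left_mono mult_right_mono powr_mono2) auto
  finally show ?thesis
    by (simp add: algebra_simps)
qed

section \<open>The sequences A_n and D_n and their limits\<close>

lemma A_seq_0 [simp]: "A_seq a 0 = 1"
  by (simp add: A_seq_def)

lemma A_seq_Suc: "A_seq a (Suc n) = A_seq a n * a (Suc n)"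
  by (simp add: A_seq_def)

lemma D_seq_0 [simp]: "D_seq r a c 0 = 1"
  by (simp add: D_seq_def)

lemma D_seq_Suc: "D_seq r a c (Suc n) = D_seq r a c n * (r - c (Suc n)) powr (A_seq a n - A_seq a (Suc n))"
  by (simp add: D_seq_def)

locale theta0_parameters =
  fixes r :: real and a c :: "nat \<Rightarrow> real"
  assumes r: "r > 1"
    and a: "\<And>n. n \<ge> 1 \<Longrightarrow> 0 < a n \<and> a n < 1"
    and c: "\<And>n. n \<ge> 1 \<Longrightarrow> 0 \<le> c n \<and> c n \<le> 1"
begin

abbreviation "A \<equiv> lim (A_seq a)"
abbreviation "D \<equiv> lim (D_seq r a c)"

text \<open>\<open>F n\<close> is the composition \<open>f_1 \<circ> \<dots> \<circ> f_n\<close>.\<close>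

definition F :: "nat \<Rightarrow> real \<Rightarrow> real" where
  "F n s = r - D_seq r a c n * (r - s) powr A_seq a n"

lemma A_seq_pos: "0 < A_seq a n"
  using a by (auto simp: A_seq_def intro: prod_pos)

lemma decseq_A_seq: "decseq (A_seq a)"
proof (rule decseq_SucI)
  show "A_seq a (Suc n) \<le> A_seq a n" for n
    using a[of "Suc n"] A_seq_pos[of n] by (simp add: A_seq_Suc mult_le_cancel_left1)
qed

lemma A_seq_tendsto: "A_seq a \<longlonglongrightarrow> A"
proof -
  obtain L where "A_seq a \<longlonglongrightarrow> L"
    using decseq_convergent[OF decseq_A_seq, of 0] less_imp_le[OF A_seq_pos] by blast
  then show ?thesis by (simp add: limI)
qed

lemma A_le_A_seq: "A \<le> A_seq a n"
  by (rule decseq_ge[OF decseq_A_seq A_seq_tendsto])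

lemma A_nonneg: "0 \<le> A" and A_less_1: "A < 1"
proof -
  show "0 \<le> A"
    using A_seq_pos by (intro LIMSEQ_le_const[OF A_seq_tendsto]) (auto intro: less_imp_le)
  show "A < 1"
    using A_le_A_seq[of 1] a[of 1] by (simp add: A_seq_def)
qed

lemma A_seq_Suc_le: "A_seq a (Suc n) \<le> A_seq a n"
  using decseq_A_seq by (simp add: decseq_Suc_iff)

lemma D_seq_pos: "0 < D_seq r a c n"
proof -
  have "0 < (r - c i) powr (A_seq a (i - 1) - A_seq a i)" if "i \<in> {1..n}" for i
    using c[of i] r that by simp
  then show ?thesis
    unfolding D_seq_def by (intro prod_pos) auto
qed

text \<open>Each base lies between r - 1 and r, and the exponents A_(i-1) - A_i telescope to 1 -
  A_n.\<close>

lemma D_seq_bounds: "(r - 1) powr (1 - A_seq a n) \<le> D_seq r a c n \<and> D_seq r a c n \<le> r powr (1 - A_seq a n)"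
proof (induction n)
  case (Suc n)
  have split: "x powr (1 - A_seq a (Suc n)) = x powr (1 - A_seq a n) * x powr (A_seq a n - A_seq a (Suc n))" for x
    by (simp flip: powr_add)
  have factor: "(r - 1) powr (A_seq a n - A_seq a (Suc n)) \<le> (r - c (Suc n)) powr (A_seq a n - A_seq a (Suc n))"
    "(r - c (Suc n)) powr (A_seq a n - A_seq a (Suc n)) \<le> r powr (A_seq a n - A_seq a (Suc n))"
    using A_seq_Suc_le[of n] r c[of "Suc n"] by (auto intro: powr_mono2)
  show ?case
    unfolding split D_seq_Suc using Suc factor D_seq_pos[of n]
    by (auto intro!: mult_mono)
qed (use r in simp)

text \<open>ln D_n is a partial sum of a series dominated by a multiple of the telescoping series of
  A_n - A_(n+1). The limit is an exponential, hence positive.\<close>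

lemma D_limit: "D_seq r a c \<longlonglongrightarrow> D" "0 < D"
proof -
  define x where "x n = (A_seq a n - A_seq a (Suc n)) * ln (r - c (Suc n))" for n
  have D_exp: "D_seq r a c n = exp (\<Sum>i<n. x i)" for n
  proof (induction n)
    case (Suc n)
    then show ?case
      using c[of "Suc n"] r by (simp add: D_seq_Suc x_def powr_def exp_add mult_ac)
  qed simp
  \<comment> \<open>Absolute values of both end points are needed because ln (r - 1) is negative for
    r < 2.\<close>
  define K where "K = max \<bar>ln r\<bar> \<bar>ln (r - 1)\<bar>"
  have "norm (x n) \<le> (A_seq a n - A_seq a (Suc n)) * K" for n
  proof -
    have "ln (r - 1) \<le> ln (r - c (Suc n))" "ln (r - c (Suc n)) \<le> ln r"
      using c[of "Suc n"] r by auto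
    then have "\<bar>ln (r - c (Suc n))\<bar> \<le> K"
      unfolding K_def by linarith
    then show ?thesis
      using A_seq_Suc_le[of n] by (simp add: x_def abs_mult mult_left_mono)
  qed
  moreover have "summable (\<lambda>n. (A_seq a n - A_seq a (Suc n)) * K)"
    by (intro summable_mult2 telescope_summable'[OF A_seq_tendsto])
  ultimately have "summable x"
    by (rule summable_comparison_test'[rotated])
  then have "(\<lambda>n. exp (\<Sum>i<n. x i)) \<longlonglongrightarrow> exp (suminf x)"
    by (intro tendsto_exp summable_LIMSEQ)
  then have "D_seq r a c \<longlonglongrightarrow> exp (suminf x)"
    by (simp add: D_exp[abs_def])
  then show "D_seq r a c \<longlonglongrightarrow> D" "0 < D"
    by (simp_all add: limI)
qed

text \<open>The product over i \<le> n is D_(n+1), and \<open>has_prod\<close> here rests on the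
  limit being nonzero.\<close>

lemma has_prod_D: "(\<lambda>n. (r - c (Suc n)) powr (A_seq a n - A_seq a (Suc n))) has_prod D"
proof -
  have "(\<Prod>i<n. (r - c (Suc i)) powr (A_seq a i - A_seq a (Suc i))) = D_seq r a c n" for n
    by (induction n) (simp_all add: D_seq_Suc)
  then have "(\<lambda>n. \<Prod>i\<le>n. (r - c (Suc i)) powr (A_seq a i - A_seq a (Suc i))) = (\<lambda>n. D_seq r a c (Suc n))"
    by (simp flip: lessThan_Suc_atMost)
  then show ?thesis
    using LIMSEQ_Suc[OF D_limit(1)] D_limit(2)
    by (auto simp: has_prod_def raw_has_prod_def)
qed

lemma D_bounds: "(r - 1) powr (1 - A) \<le> D" "D \<le> r powr (1 - A)"
proof -
  have lim: "(\<lambda>n. x powr (1 - A_seq a n)) \<longlonglongrightarrow> x powr (1 - A)" if "x > 0" for x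
    using that by (intro tendsto_intros A_seq_tendsto) auto
  show "(r - 1) powr (1 - A) \<le> D"
    using r D_seq_bounds by (intro LIMSEQ_le[OF lim D_limit(1)]) auto
  show "D \<le> r powr (1 - A)"
    using r D_seq_bounds by (intro LIMSEQ_le[OF D_limit(1) lim]) auto
qed

section \<open>The composed generating functions\<close>

text \<open>Raising r - f_(n+1)(s) to the power A_n multiplies exponents: a_(n+1) A_n = A_(n+1),
  while (1 - a_(n+1)) A_n = A_n - A_(n+1) yields the new factor of D_(n+1).\<close>

lemma F_theta0_pgf:
  assumes "s \<le> 1"
  shows "F n (theta0_pgf r (a (Suc n)) (c (Suc n)) s) = F (Suc n) s"
proof -
  have "A_seq a n - A_seq a (Suc n) = (1 - a (Suc n)) * A_seq a n"
    by (simp add: A_seq_Suc algebra_simps)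
  then show ?thesis
    using assms r c[of "Suc n"]
    by (simp add: F_def theta0_pgf_def D_seq_Suc powr_mult powr_powr A_seq_Suc mult_ac)
qed

lemma F_tendsto:
  assumes "s \<le> 1"
  shows "(\<lambda>n. F n s) \<longlonglongrightarrow> r - (r - s) powr A * D"
  unfolding F_def mult.commute[of "D_seq r a c _"]
  using assms r by (intro tendsto_intros A_seq_tendsto D_limit(1)) auto

lemma F_deriv_1:
  "(F n has_real_derivative A_seq a n * (r - 1) powr (A_seq a n - 1) * D_seq r a c n) (at 1 within S)"
  unfolding F_def[abs_def]
  by (rule derivative_eq_intros refl | use r in simp)+

lemma mean_tendsto:
  "(\<lambda>n. A_seq a n * (r - 1) powr (A_seq a n - 1) * D_seq r a c n) \<longlonglongrightarrow> A * (r - 1) powr (A - 1) * D"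
  using r by (intro tendsto_intros A_seq_tendsto D_limit(1)) auto

text \<open>1 - a_(n+1) = (A_n - A_(n+1)) / A_n, and A_n \<ge> A leaves a telescoping
  majorant.\<close>

lemma summable_1_minus_a:
  assumes "A > 0"
  shows "summable (\<lambda>n. 1 - a (Suc n))"
proof (rule summable_comparison_test')
  show "summable (\<lambda>n. inverse A * (A_seq a n - A_seq a (Suc n)))"
    by (intro summable_mult telescope_summable'[OF A_seq_tendsto])
  show "norm (1 - a (Suc n)) \<le> inverse A * (A_seq a n - A_seq a (Suc n))" for n
  proof -
    have "A * (1 - a (Suc n)) \<le> A_seq a n * (1 - a (Suc n))"
      using A_le_A_seq a[of "Suc n"] by (intro mult_right_mono) auto
    then show ?thesis
      using assms a[of "Suc n"] by (simp add: A_seq_Suc field_simps)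
  qed
qed

text \<open>The ratio is the difference quotient of x \<mapsto> r^x - (r - s)^x between 0, where
  this function vanishes, and A_n, which tends to 0 through positive values.\<close>

lemma F_increment_tendsto:
  assumes A0: "A = 0" and s: "s \<le> 1"
  shows "(\<lambda>n. (F n s - F n 0) / (A_seq a n * D_seq r a c n)) \<longlonglongrightarrow> ln r - ln (r - s)"
proof -
  have "((\<lambda>x. r powr x - (r - s) powr x) has_real_derivative ln r - ln (r - s)) (at 0)"
    by (rule derivative_eq_intros refl | use r s in simp)+
  then have "((\<lambda>x. (r powr x - (r - s) powr x) / x) \<longlongrightarrow> ln r - ln (r - s)) (at 0)"
    using r s by (simp add: has_field_derivative_iff)
  moreover have "filterlim (A_seq a) (at 0) sequentially"
    using A_seq_tendsto A_seq_pos by (auto simp: filterlim_at A0 less_imp_neq[symmetric])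
  ultimately have "(\<lambda>n. (r powr A_seq a n - (r - s) powr A_seq a n) / A_seq a n) \<longlonglongrightarrow> ln r - ln (r - s)"
    by (rule filterlim_compose)
  moreover have "(F n s - F n 0) / (A_seq a n * D_seq r a c n) = (r powr A_seq a n - (r - s) powr A_seq a n) / A_seq a n" for n
  proof -
    have "F n s - F n 0 = D_seq r a c n * (r powr A_seq a n - (r - s) powr A_seq a n)"
      by (simp add: F_def algebra_simps)
    then show ?thesis
      using D_seq_pos[of n] by simp
  qed
  ultimately show ?thesis by simp
qed

end

section \<open>The theta = 0 process\<close>

text \<open>The partial sums are expectations of the truncations \<open>g N\<close>, which are
  bounded by 1 and eventually equal to the killed power. The mass at \<Delta> contributes 0, so
  defective laws are included.\<close>

lemma (in prob_space) killed_power_sums: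
  assumes X [measurable]: "X \<in> M \<rightarrow>\<^sub>M count_space UNIV" and s: "0 \<le> s" "s \<le> 1"
  shows "(\<lambda>j. \<P>(\<omega> in M. X \<omega> = Some j) * s ^ j) sums expectation (\<lambda>\<omega>. killed_power s (X \<omega>))"
proof -
  define g where "g N \<omega> = (\<Sum>j<N. indicator {\<omega> \<in> space M. X \<omega> = Some j} \<omega> * s ^ j)" for N \<omega>
  have g: "g N \<omega> = (case X \<omega> of None \<Rightarrow> 0 | Some k \<Rightarrow> if k < N then s ^ k else 0)" if "\<omega> \<in> space M" for N \<omega>
  proof (cases "X \<omega>")
    case (Some k)
    have "g N \<omega> = (\<Sum>j<N. if j = k then s ^ k else 0)"
      unfolding g_def using that Some by (intro sum.cong) auto
    then show ?thesis using Some by simp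
  qed (simp add: g_def)
  have "(\<lambda>N. expectation (g N)) \<longlonglongrightarrow> expectation (\<lambda>\<omega>. killed_power s (X \<omega>))"
  proof (rule integral_dominated_convergence[where w = "\<lambda>_. 1"])
    show "AE \<omega> in M. (\<lambda>N. g N \<omega>) \<longlonglongrightarrow> killed_power s (X \<omega>)"
    proof (rule AE_I2)
      fix \<omega> assume \<omega>: "\<omega> \<in> space M"
      have "\<forall>\<^sub>F N in sequentially. g N \<omega> = killed_power s (X \<omega>)"
      proof (cases "X \<omega>")
        case (Some k)
        show ?thesis
          using eventually_gt_at_top[of k] by eventually_elim (simp add: g[OF \<omega>] Some)
      qed (simp add: g[OF \<omega>])
      then show "(\<lambda>N. g N \<omega>) \<longlonglongrightarrow> killed_power s (X \<omega>)"
        by (rule tendsto_eventually)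
    qed
    show "AE \<omega> in M. norm (g N \<omega>) \<le> 1" for N
      using s by (auto simp: g power_le_one split: option.split)
    show "g N \<in> borel_measurable M" for N
      unfolding g_def by measurable
  qed simp_all
  moreover have "expectation (g N) = (\<Sum>j<N. \<P>(\<omega> in M. X \<omega> = Some j) * s ^ j)" for N
    unfolding g_def
    by (subst Bochner_Integration.integral_sum)
       (auto intro!: integrable_mult_left integrable_real_indicator simp: emeasure_eq_measure)
  ultimately show ?thesis
    by (simp add: sums_def)
qed

locale gw_theta0 = theta0_parameters r a c + galton_watson M \<xi> Z
  for M :: "'w measure" and r a c \<xi> Z +
  fixes p :: "nat \<Rightarrow> nat \<Rightarrow> real"
  assumes p_sums: "\<And>n s. n \<ge> 1 \<Longrightarrow> s \<in> {0..1} \<Longrightarrow> (\<lambda>j. p n j * s ^ j) sums theta0_pgf r (a n) (c n) s"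
    and offspring_law: "\<And>n i j. n \<ge> 1 \<Longrightarrow> \<P>(\<omega> in M. \<xi> n i \<omega> = Some j) = p n j"
begin

lemma expectation_killed_power_offspring:
  assumes s: "0 \<le> s" "s \<le> 1"
  shows "expectation (\<lambda>\<omega>. killed_power s (\<xi> (Suc n) i \<omega>)) = theta0_pgf r (a (Suc n)) (c (Suc n)) s"
proof -
  have "(\<lambda>j. p (Suc n) j * s ^ j) sums expectation (\<lambda>\<omega>. killed_power s (\<xi> (Suc n) i \<omega>))"
    using killed_power_sums[OF offspring_measurable s, of n i] by (simp add: offspring_law)
  then show ?thesis
    using p_sums[of "Suc n" s] s by (auto intro: sums_unique2)
qed

lemma expectation_killed_power_Z:
  assumes "0 \<le> s" "s \<le> 1"
  shows "expectation (\<lambda>\<omega>. killed_power s (Z n \<omega>)) = F n s"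
  using assms
\<comment> \<open>The argument s varies because the induction hypothesis is used at
  f_(n+1)(s).\<close>
proof (induction n arbitrary: s)
  case 0
  have "expectation (\<lambda>\<omega>. killed_power s (Z 0 \<omega>)) = expectation (\<lambda>_. s)"
    by (intro Bochner_Integration.integral_cong) (simp_all add: Z_0)
  also have "\<dots> = F 0 s"
    using 0 r by (simp add: F_def prob_space)
  finally show ?case .
next
  case (Suc n)
  let ?m = "theta0_pgf r (a (Suc n)) (c (Suc n)) s"
  \<comment> \<open>The bounds hold because \<open>?m\<close> is the expectation of a variable with
    values in [0, 1].\<close>
  have m: "0 \<le> ?m" "?m \<le> 1"
  proof -
    have "integrable M (\<lambda>\<omega>. killed_power s (\<xi> (Suc n) 0 \<omega>))"
      by (intro integrable_const_bound[of _ 1]) (auto simp: Suc.prems abs_killed_power_le_1)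
    then have "expectation (\<lambda>\<omega>. killed_power s (\<xi> (Suc n) 0 \<omega>)) \<le> 1"
      using Suc.prems by (intro integral_le_const) (auto simp: killed_power_le_1)
    moreover have "0 \<le> expectation (\<lambda>\<omega>. killed_power s (\<xi> (Suc n) 0 \<omega>))"
      using Suc.prems by (intro integral_nonneg_AE) (auto simp: killed_power_nonneg)
    ultimately show "0 \<le> ?m" "?m \<le> 1"
      by (simp_all add: expectation_killed_power_offspring Suc.prems)
  qed
  have "expectation (\<lambda>\<omega>. killed_power s (Z (Suc n) \<omega>)) = expectation (\<lambda>\<omega>. killed_power ?m (Z n \<omega>))"
    using Suc.prems m by (intro expectation_killed_power_Suc expectation_killed_power_offspring)
  also have "\<dots> = F (Suc n) s"
    using Suc.IH[OF m] F_theta0_pgf Suc.prems by simp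
  finally show ?case .
qed

lemma mean_Z:
  shows "integrable M (\<lambda>\<omega>. case Z n \<omega> of None \<Rightarrow> 0 | Some k \<Rightarrow> real k)"
    and "expectation (\<lambda>\<omega>. case Z n \<omega> of None \<Rightarrow> 0 | Some k \<Rightarrow> real k) =
      A_seq a n * (r - 1) powr (A_seq a n - 1) * D_seq r a c n"
  using expectation_Z_eq_deriv[OF _ F_deriv_1] expectation_killed_power_Z by auto

section \<open>Absorption probabilities and expectations before absorption\<close>

abbreviation "\<tau>0 \<equiv> absorption_time Z (Some 0)"
abbreviation "\<tau>\<Delta> \<equiv> absorption_time Z None"

lemma less_\<tau>0: "\<omega> \<in> space M \<Longrightarrow> enat n < \<tau>0 \<omega> \<longleftrightarrow> Z n \<omega> \<noteq> Some 0"
  by (intro enat_less_absorption_time_iff absorbing_0)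

lemma less_\<tau>\<Delta>: "\<omega> \<in> space M \<Longrightarrow> enat n < \<tau>\<Delta> \<omega> \<longleftrightarrow> Z n \<omega> \<noteq> None"
  by (intro enat_less_absorption_time_iff absorbing_None)

lemma prob_\<tau>0_finite: "\<P>(\<omega> in M. \<tau>0 \<omega> < \<infinity>) = r - r powr A * D"
proof -
  have "prob {\<omega> \<in> space M. Z n \<omega> = Some 0} = F n 0" for n
    by (simp add: prob_Z_eq_0 expectation_killed_power_Z)
  then have "(\<lambda>n. F n 0) \<longlonglongrightarrow> \<P>(\<omega> in M. \<tau>0 \<omega> < \<infinity>)"
    using prob_tendsto_absorption[OF absorbing_0] by simp
  then show ?thesis
    using LIMSEQ_unique F_tendsto[of 0] by force
qed

lemma prob_Z_eq_None: "prob {\<omega> \<in> space M. Z n \<omega> = None} = 1 - F n 1"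
proof -
  have "prob {\<omega> \<in> space M. \<not> Z n \<omega> \<noteq> None} = 1 - prob {\<omega> \<in> space M. Z n \<omega> \<noteq> None}"
    by (intro prob_neg) measurable
  then show ?thesis
    by (simp add: prob_Z_neq_None expectation_killed_power_Z del: not_None_eq)
qed

lemma prob_\<tau>\<Delta>_finite: "\<P>(\<omega> in M. \<tau>\<Delta> \<omega> < \<infinity>) = 1 - r + (r - 1) powr A * D"
proof -
  have "(\<lambda>n. 1 - F n 1) \<longlonglongrightarrow> \<P>(\<omega> in M. \<tau>\<Delta> \<omega> < \<infinity>)"
    using prob_tendsto_absorption[OF absorbing_None] by (simp add: prob_Z_eq_None)
  moreover have "(\<lambda>n. 1 - F n 1) \<longlonglongrightarrow> 1 - (r - (r - 1) powr A * D)"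
    by (intro tendsto_intros F_tendsto) simp
  ultimately show ?thesis
    using LIMSEQ_unique by fastforce
qed

text \<open>Subtracting \<open>killed_power 0\<close>, the indicator of state 0, leaves s^Z_n off
  both absorbing states. The unspecified \<open>the None\<close> is masked by the event.\<close>

lemma expectation_power_alive:
  assumes s: "0 \<le> s" "s \<le> 1"
  shows "expectation_on M (\<lambda>\<omega>. s ^ the (Z n \<omega>)) (\<lambda>\<omega>. enat n < min (\<tau>0 \<omega>) (\<tau>\<Delta> \<omega>)) = F n s - F n 0"
proof -
  have "expectation_on M (\<lambda>\<omega>. s ^ the (Z n \<omega>)) (\<lambda>\<omega>. enat n < min (\<tau>0 \<omega>) (\<tau>\<Delta> \<omega>)) =
      expectation (\<lambda>\<omega>. killed_power s (Z n \<omega>) - killed_power 0 (Z n \<omega>))"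
    unfolding expectation_on_def set_lebesgue_integral_def
    by (intro Bochner_Integration.integral_cong)
       (auto simp: less_\<tau>0 less_\<tau>\<Delta> killed_power_def indicator_def split: option.split)
  also have "\<dots> = F n s - F n 0"
    using s by (simp add: Bochner_Integration.integral_diff killed_power_Z_integrable expectation_killed_power_Z)
  finally show ?thesis .
qed

lemma prob_alive: "\<P>(\<omega> in M. enat n < min (\<tau>0 \<omega>) (\<tau>\<Delta> \<omega>)) = F n 1 - F n 0"
proof -
  have "{\<omega> \<in> space M. enat n < min (\<tau>0 \<omega>) (\<tau>\<Delta> \<omega>)} = {\<omega> \<in> space M. Z n \<omega> \<noteq> Some 0 \<and> Z n \<omega> \<noteq> None}"
    by (auto simp: less_\<tau>0 less_\<tau>\<Delta>)
  also have "\<dots> \<in> events"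
    by measurable
  finally show ?thesis
    using expectation_power_alive[of 1 n]
    by (simp add: expectation_on_def set_lebesgue_integral_def del: min_less_iff_conj)
qed

lemma mean_not_killed:
  shows "set_integrable M {\<omega> \<in> space M. enat n < \<tau>\<Delta> \<omega>} (\<lambda>\<omega>. real (the (Z n \<omega>)))"
    and "expectation_on M (\<lambda>\<omega>. real (the (Z n \<omega>))) (\<lambda>\<omega>. enat n < \<tau>\<Delta> \<omega>) =
      A_seq a n * (r - 1) powr (A_seq a n - 1) * D_seq r a c n"
proof -
  have eq: "indicator {\<omega> \<in> space M. enat n < \<tau>\<Delta> \<omega>} \<omega> *\<^sub>R real (the (Z n \<omega>)) =
      (case Z n \<omega> of None \<Rightarrow> 0 | Some k \<Rightarrow> real k)" if "\<omega> \<in> space M" for \<omega>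
    using that by (auto simp: less_\<tau>\<Delta> split: option.split)
  show "set_integrable M {\<omega> \<in> space M. enat n < \<tau>\<Delta> \<omega>} (\<lambda>\<omega>. real (the (Z n \<omega>)))"
    unfolding set_integrable_def
    by (subst Bochner_Integration.integrable_cong[OF refl eq]) (simp_all add: mean_Z)
  show "expectation_on M (\<lambda>\<omega>. real (the (Z n \<omega>))) (\<lambda>\<omega>. enat n < \<tau>\<Delta> \<omega>) =
      A_seq a n * (r - 1) powr (A_seq a n - 1) * D_seq r a c n"
    unfolding expectation_on_def set_lebesgue_integral_def
    by (subst Bochner_Integration.integral_cong[OF refl eq]) (simp_all add: mean_Z)
qed

text \<open>The state 0 adds nothing to the mean, so the value is the same as on the event that the
  process is not killed.\<close>

lemma mean_alive:
  shows "set_integrable M {\<omega> \<in> space M. enat n < min (\<tau>0 \<omega>) (\<tau>\<Delta> \<omega>)} (\<lambda>\<omega>. real (the (Z n \<omega>)))"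
    and "expectation_on M (\<lambda>\<omega>. real (the (Z n \<omega>))) (\<lambda>\<omega>. enat n < min (\<tau>0 \<omega>) (\<tau>\<Delta> \<omega>)) =
      A_seq a n * (r - 1) powr (A_seq a n - 1) * D_seq r a c n"
proof -
  have eq: "indicator {\<omega> \<in> space M. enat n < min (\<tau>0 \<omega>) (\<tau>\<Delta> \<omega>)} \<omega> *\<^sub>R real (the (Z n \<omega>)) =
      (case Z n \<omega> of None \<Rightarrow> 0 | Some k \<Rightarrow> real k)" if "\<omega> \<in> space M" for \<omega>
    using that by (auto simp: less_\<tau>0 less_\<tau>\<Delta> indicator_def split: option.split)
  show "set_integrable M {\<omega> \<in> space M. enat n < min (\<tau>0 \<omega>) (\<tau>\<Delta> \<omega>)} (\<lambda>\<omega>. real (the (Z n \<omega>)))"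
    unfolding set_integrable_def
    by (subst Bochner_Integration.integrable_cong[OF refl eq]) (simp_all add: mean_Z)
  show "expectation_on M (\<lambda>\<omega>. real (the (Z n \<omega>))) (\<lambda>\<omega>. enat n < min (\<tau>0 \<omega>) (\<tau>\<Delta> \<omega>)) =
      A_seq a n * (r - 1) powr (A_seq a n - 1) * D_seq r a c n"
    unfolding expectation_on_def set_lebesgue_integral_def
    by (subst Bochner_Integration.integral_cong[OF refl eq]) (simp_all add: mean_Z)
qed

section \<open>Limits conditioned on survival when A = 0\<close>

lemma log_ratio_pos: "0 < ln r - ln (r - 1)"
  using r by simp

lemma prob_alive_asymp:
  assumes "A = 0"
  shows "(\<lambda>n. \<P>(\<omega> in M. enat n < min (\<tau>0 \<omega>) (\<tau>\<Delta> \<omega>))) \<sim>[sequentially]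
    (\<lambda>n. (ln r - ln (r - 1)) * A_seq a n * D_seq r a c n)"
proof (rule asymp_equivI')
  have "(\<lambda>n. (F n 1 - F n 0) / (A_seq a n * D_seq r a c n) / (ln r - ln (r - 1)))
      \<longlonglongrightarrow> (ln r - ln (r - 1)) / (ln r - ln (r - 1))"
    using log_ratio_pos by (intro tendsto_divide F_increment_tendsto[OF assms] tendsto_const) auto
  then show "(\<lambda>n. \<P>(\<omega> in M. enat n < min (\<tau>0 \<omega>) (\<tau>\<Delta> \<omega>)) / ((ln r - ln (r - 1)) * A_seq a n * D_seq r a c n))
      \<longlonglongrightarrow> 1"
    using log_ratio_pos by (simp add: prob_alive mult_ac del: min_less_iff_conj)
qed

text \<open>The conditional expectation is the quotient of the increments of F_n at s and at 1, in
  which the normalization A_n D_n cancels.\<close>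

lemma expectation_power_given_alive_tendsto:
  assumes "A = 0" and s: "0 \<le> s" "s \<le> 1"
  shows "(\<lambda>n. expectation_given M (\<lambda>\<omega>. s ^ the (Z n \<omega>)) (\<lambda>\<omega>. enat n < min (\<tau>0 \<omega>) (\<tau>\<Delta> \<omega>)))
    \<longlonglongrightarrow> (ln r - ln (r - s)) / (ln r - ln (r - 1))"
proof -
  have "(\<lambda>n. ((F n s - F n 0) / (A_seq a n * D_seq r a c n)) / ((F n 1 - F n 0) / (A_seq a n * D_seq r a c n)))
      \<longlonglongrightarrow> (ln r - ln (r - s)) / (ln r - ln (r - 1))"
    using log_ratio_pos s by (intro tendsto_divide F_increment_tendsto[OF assms(1)]) auto
  moreover have "((F n s - F n 0) / (A_seq a n * D_seq r a c n)) / ((F n 1 - F n 0) / (A_seq a n * D_seq r a c n)) =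
      expectation_given M (\<lambda>\<omega>. s ^ the (Z n \<omega>)) (\<lambda>\<omega>. enat n < min (\<tau>0 \<omega>) (\<tau>\<Delta> \<omega>))" for n
    using A_seq_pos[of n] D_seq_pos[of n] s
    by (simp add: expectation_given_def expectation_power_alive prob_alive del: min_less_iff_conj)
  ultimately show ?thesis by simp
qed

text \<open>Dividing the mean and the survival probability by A_n D_n leaves (r - 1)^(A_n - 1) over
  a quotient tending to the logarithmic constant.\<close>

lemma mean_given_alive_tendsto:
  assumes "A = 0"
  shows "(\<lambda>n. expectation_given M (\<lambda>\<omega>. real (the (Z n \<omega>))) (\<lambda>\<omega>. enat n < min (\<tau>0 \<omega>) (\<tau>\<Delta> \<omega>)))
    \<longlonglongrightarrow> inverse (r - 1) / (ln r - ln (r - 1))"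
proof -
  have "(\<lambda>n. (r - 1) powr (A_seq a n - 1) / ((F n 1 - F n 0) / (A_seq a n * D_seq r a c n)))
      \<longlonglongrightarrow> (r - 1) powr (A - 1) / (ln r - ln (r - 1))"
    using log_ratio_pos r
    by (intro tendsto_divide F_increment_tendsto[OF assms] tendsto_powr tendsto_diff A_seq_tendsto tendsto_const) auto
  moreover have "(r - 1) powr (A_seq a n - 1) / ((F n 1 - F n 0) / (A_seq a n * D_seq r a c n)) =
      expectation_given M (\<lambda>\<omega>. real (the (Z n \<omega>))) (\<lambda>\<omega>. enat n < min (\<tau>0 \<omega>) (\<tau>\<Delta> \<omega>))" for n
    by (simp add: expectation_given_def mean_alive prob_alive mult_ac del: min_less_iff_conj)
  moreover have "(r - 1) powr (A - 1) = inverse (r - 1)"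
    using assms r by (simp add: powr_minus)
  ultimately show ?thesis by simp
qed

section \<open>The almost sure limit when A > 0\<close>

lemma AE_eventually_constant:
  assumes "A > 0"
  shows "AE \<omega> in M. \<forall>\<^sub>F n in sequentially. Z n \<omega> = Z_limit \<omega>"
proof (rule AE_eventually_eq_Z_limit)
  let ?mean = "\<lambda>n. A_seq a n * (r - 1) powr (A_seq a n - 1) * D_seq r a c n"
  let ?K = "1 + ln (r / (r - 1))"
  \<comment> \<open>The means converge, so one constant \<open>C\<close> bounds them in all
    generations.\<close>
  have "Bseq ?mean"
    using mean_tendsto by (intro convergent_imp_Bseq convergentI)
  then obtain C where C: "C > 0" "\<And>n. norm (?mean n) \<le> C"
    by (auto simp: Bseq_def)
  have bound: "prob {\<omega> \<in> space M. Z (Suc n) \<omega> \<noteq> Z n \<omega>} \<le> C * ?K * (1 - a (Suc n))" for n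
  proof -
    \<comment> \<open>The coefficients are probabilities, here those of individual 0.\<close>
    have p_nonneg: "0 \<le> p (Suc n) j" for j
      by (simp flip: offspring_law[of "Suc n" 0])
    have "(r - c (Suc n)) powr (1 - a (Suc n)) * (a (Suc n) * r powr (a (Suc n) - 1)) \<le> p (Suc n) 1"
      using r by (intro coeff_1_ge_deriv[OF p_nonneg p_sums theta0_pgf_deriv_0]) auto
    then have p1: "1 - p (Suc n) 1 \<le> ?K * (1 - a (Suc n))"
      using theta0_pgf_deriv_0_ge[OF r, of "a (Suc n)" "c (Suc n)"] a[of "Suc n"] c[of "Suc n"] by simp
    have K: "0 \<le> ?K"
      using r by simp
    have "prob {\<omega> \<in> space M. Z (Suc n) \<omega> \<noteq> Z n \<omega>} \<le> (1 - p (Suc n) 1) * ?mean n"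
      using prob_Z_change_le[OF offspring_law mean_Z(1)] by (simp add: mean_Z)
    also have "\<dots> \<le> (?K * (1 - a (Suc n))) * C"
      using p1 C(2)[of n] K a[of "Suc n"] A_seq_pos[of n] D_seq_pos[of n]
      by (intro mult_mono) (auto intro: less_imp_le)
    finally show ?thesis by (simp add: mult_ac)
  qed
  show "summable (\<lambda>n. prob {\<omega> \<in> space M. Z (Suc n) \<omega> \<noteq> Z n \<omega>})"
    by (rule summable_comparison_test'[OF summable_mult[OF summable_1_minus_a[OF assms]]])
       (use bound in auto)
qed

lemma expectation_killed_power_Z_limit:
  assumes "A > 0" and s: "0 \<le> s" "s \<le> 1"
  shows "expectation (\<lambda>\<omega>. killed_power s (Z_limit \<omega>)) = r - (r - s) powr A * D"
proof -
  have "(\<lambda>n. F n s) \<longlonglongrightarrow> expectation (\<lambda>\<omega>. killed_power s (Z_limit \<omega>))"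
    using expectation_killed_power_tendsto_Z_limit[OF AE_eventually_constant[OF assms(1)] s]
    by (simp add: expectation_killed_power_Z s)
  then show ?thesis
    using F_tendsto[OF s(2)] LIMSEQ_unique by blast
qed

lemma expectation_on_Z_limit:
  assumes "A > 0" and s: "0 \<le> s" "s \<le> 1"
  shows "expectation_on M (\<lambda>\<omega>. s ^ the (Z_limit \<omega>)) (\<lambda>\<omega>. Z_limit \<omega> \<noteq> None) = r - (r - s) powr A * D"
proof -
  have "expectation_on M (\<lambda>\<omega>. s ^ the (Z_limit \<omega>)) (\<lambda>\<omega>. Z_limit \<omega> \<noteq> None) =
      expectation (\<lambda>\<omega>. killed_power s (Z_limit \<omega>))"
    unfolding expectation_on_def set_lebesgue_integral_def
    by (intro Bochner_Integration.integral_cong) (auto simp: killed_power_def split: option.split)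
  then show ?thesis
    by (simp add: expectation_killed_power_Z_limit assms)
qed

text \<open>The complement of the total mass off \<Delta>, which is the generating function of the
  limit at s = 1.\<close>

lemma prob_Z_limit_eq_None:
  assumes "A > 0"
  shows "\<P>(\<omega> in M. Z_limit \<omega> = None) = 1 - r + (r - 1) powr A * D"
proof -
  have "prob {\<omega> \<in> space M. \<not> Z_limit \<omega> \<noteq> None} = 1 - prob {\<omega> \<in> space M. Z_limit \<omega> \<noteq> None}"
    by (intro prob_neg) measurable
  moreover have "{\<omega> \<in> space M. Z_limit \<omega> \<noteq> None} \<in> events"
    by measurable
  then have "prob {\<omega> \<in> space M. Z_limit \<omega> \<noteq> None} = r - (r - 1) powr A * D"
    using expectation_on_Z_limit[OF assms, of 1]
    by (simp add: expectation_on_def set_lebesgue_integral_def del: not_None_eq)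
  ultimately show ?thesis
    by (simp del: not_None_eq)
qed

end

section \<open>Assembly of the statement\<close>

lemma GW_theta0_imp_gw_theta0:
  assumes "r > 1" and "\<And>n. n \<ge> 1 \<Longrightarrow> 0 < a n \<and> a n < 1" and "\<And>n. n \<ge> 1 \<Longrightarrow> 0 \<le> c n \<and> c n \<le> 1"
    and "GW_theta0 M r a c Z"
  shows "\<exists>\<xi> p. gw_theta0 M r a c \<xi> Z p"
proof -
  obtain p where p: "\<forall>n\<ge>1. \<forall>s\<in>{0..1}. (\<lambda>j. p n j * s ^ j) sums theta0_pgf r (a n) (c n) s"
    and "GW_varying M p Z"
    using assms(4) by (auto simp: GW_theta0_def)
  then obtain \<xi> where "gw_theta0_axioms M r a c \<xi> p" "galton_watson M \<xi> Z"
    unfolding GW_varying_def galton_watson_def galton_watson_axioms_def gw_theta0_axioms_def by blast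
  with assms(1-3) show ?thesis
    unfolding gw_theta0_def theta0_parameters_def by blast
qed

theorem theorem9:
  fixes M :: "'w measure" and Z :: "nat \<Rightarrow> 'w \<Rightarrow> nat option"
    and r :: real and a c :: "nat \<Rightarrow> real"
    and \<tau>0 \<tau>\<Delta> \<tau> :: "'w \<Rightarrow> enat"
    and q q\<Delta> Q A D :: real
  assumes r: "r > 1"
    and a: "\<And>n. n \<ge> 1 \<Longrightarrow> 0 < a n \<and> a n < 1"
    and c: "\<And>n. n \<ge> 1 \<Longrightarrow> 0 \<le> c n \<and> c n \<le> 1"
    and Z: "GW_theta0 M r a c Z"
    and \<tau>0_eq: "\<tau>0 = absorption_time Z (Some 0)"
    and \<tau>\<Delta>_eq: "\<tau>\<Delta> = absorption_time Z None"
    and \<tau>_eq: "\<tau> = (\<lambda>\<omega>. min (\<tau>0 \<omega>) (\<tau>\<Delta> \<omega>))"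
    and q_eq: "q = \<P>(\<omega> in M. \<tau>0 \<omega> < \<infinity>)"
    and q\<Delta>_eq: "q\<Delta> = \<P>(\<omega> in M. \<tau>\<Delta> \<omega> < \<infinity>)"
    and Q_eq: "Q = \<P>(\<omega> in M. \<tau> \<omega> < \<infinity>)"
    and A_eq: "A = lim (A_seq a)"
    and D_eq: "D = lim (D_seq r a c)"
  shows "A_seq a \<longlonglongrightarrow> A \<and> A \<in> {0..<1} \<and>
    D_seq r a c \<longlonglongrightarrow> D \<and>
    (\<lambda>n. (r - c (Suc n)) powr (A_seq a n - A_seq a (Suc n))) has_prod D \<and>
    q = r - r powr A * D \<and>
    q\<Delta> = 1 - r + (r - 1) powr A * D \<and>
    Q = 1 - (r powr A - (r - 1) powr A) * D \<and>
    (A = 0 \<longrightarrow>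
      Q = 1 \<and>
      (\<lambda>n. \<P>(\<omega> in M. \<tau> \<omega> > enat n)) \<sim>[sequentially]
        (\<lambda>n. (ln r - ln (r - 1)) * A_seq a n * D_seq r a c n) \<and>
      (\<forall>n. set_integrable M {\<omega>\<in>space M. \<tau> \<omega> > enat n} (\<lambda>\<omega>. real (the (Z n \<omega>)))) \<and>
      (\<lambda>n. expectation_given M (\<lambda>\<omega>. real (the (Z n \<omega>))) (\<lambda>\<omega>. \<tau> \<omega> > enat n))
        \<longlonglongrightarrow> inverse (r - 1) / (ln r - ln (r - 1)) \<and>
      (\<forall>s\<in>{0..1}.
        (\<lambda>n. expectation_given M (\<lambda>\<omega>. s ^ the (Z n \<omega>)) (\<lambda>\<omega>. \<tau> \<omega> > enat n))
          \<longlonglongrightarrow> (ln r - ln (r - s)) / (ln r - ln (r - 1)))) \<and>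
    (A \<in> {0<..<1} \<longrightarrow>
      Q < 1 \<and>
      (r - 1) powr (1 - A) \<le> D \<and> D \<le> r powr (1 - A) \<and>
      (\<forall>n. set_integrable M {\<omega>\<in>space M. \<tau>\<Delta> \<omega> > enat n} (\<lambda>\<omega>. real (the (Z n \<omega>)))) \<and>
      (\<lambda>n. expectation_on M (\<lambda>\<omega>. real (the (Z n \<omega>))) (\<lambda>\<omega>. \<tau>\<Delta> \<omega> > enat n))
        \<longlonglongrightarrow> A * (r - 1) powr (A - 1) * D \<and>
      (\<exists>Zinf :: 'w \<Rightarrow> nat option.
        Zinf \<in> measurable M (count_space UNIV) \<and>
        (AE \<omega> in M. limitin (discrete_topology UNIV) (\<lambda>n. Z n \<omega>) (Zinf \<omega>) sequentially) \<and>
        \<P>(\<omega> in M. Zinf \<omega> = None) = 1 - r + (r - 1) powr A * D \<and>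
        (\<forall>s\<in>{0..1}.
          expectation_on M (\<lambda>\<omega>. s ^ the (Zinf \<omega>)) (\<lambda>\<omega>. Zinf \<omega> \<noteq> None) = r - (r - s) powr A * D)))"
proof -
  obtain \<xi> p where "gw_theta0 M r a c \<xi> Z p"
    using GW_theta0_imp_gw_theta0[OF r a c Z] by blast
  then interpret gw_theta0 M r a c \<xi> Z p .
  have \<tau>: "\<tau> = (\<lambda>\<omega>. min (absorption_time Z (Some 0) \<omega>) (absorption_time Z None \<omega>))"
    by (simp add: \<tau>_eq \<tau>0_eq \<tau>\<Delta>_eq)
  have q: "q = r - r powr A * D"
    unfolding q_eq \<tau>0_eq A_eq D_eq by (rule prob_\<tau>0_finite)
  have q\<Delta>: "q\<Delta> = 1 - r + (r - 1) powr A * D"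
    unfolding q\<Delta>_eq \<tau>\<Delta>_eq A_eq D_eq by (rule prob_\<tau>\<Delta>_finite)
  have "Q = q + q\<Delta>"
    unfolding Q_eq q_eq q\<Delta>_eq \<tau> \<tau>0_eq \<tau>\<Delta>_eq by (rule prob_absorbed)
  then have Q: "Q = 1 - (r powr A - (r - 1) powr A) * D"
    by (simp add: q q\<Delta> algebra_simps)
  \<comment> \<open>Both powers with exponent 0 equal 1, since r and r - 1 are nonzero.\<close>
  have extinct: "Q = 1" if "A = 0"
    using r by (simp add: Q that)
  \<comment> \<open>For A > 0 the power is strictly increasing in its base, and D > 0 keeps the
    inequality strict.\<close>
  have survive: "Q < 1" if "A \<in> {0<..<1}"
  proof -
    have "(r - 1) powr A < r powr A"
      using r that by (intro powr_less_mono2) auto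
    then show ?thesis
      using D_limit(2) by (simp add: Q D_eq)
  qed
  have Zinf: "\<exists>Zinf :: 'w \<Rightarrow> nat option.
        Zinf \<in> measurable M (count_space UNIV) \<and>
        (AE \<omega> in M. limitin (discrete_topology UNIV) (\<lambda>n. Z n \<omega>) (Zinf \<omega>) sequentially) \<and>
        \<P>(\<omega> in M. Zinf \<omega> = None) = 1 - r + (r - 1) powr A * D \<and>
        (\<forall>s\<in>{0..1}.
          expectation_on M (\<lambda>\<omega>. s ^ the (Zinf \<omega>)) (\<lambda>\<omega>. Zinf \<omega> \<noteq> None) = r - (r - s) powr A * D)"
    if "A \<in> {0<..<1}"
  proof (intro exI[of _ Z_limit] conjI ballI)
    have pos: "lim (A_seq a) > 0"
      using that by (simp add: A_eq)
    \<comment> \<open>Convergence in the discrete topology follows from eventual equality with the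
      limit.\<close>
    show "AE \<omega> in M. limitin (discrete_topology UNIV) (\<lambda>n. Z n \<omega>) (Z_limit \<omega>) sequentially"
      using AE_eventually_constant[OF pos]
      by eventually_elim (auto simp: limitin_def elim: eventually_mono)
    show "\<P>(\<omega> in M. Z_limit \<omega> = None) = 1 - r + (r - 1) powr A * D"
      unfolding A_eq D_eq by (rule prob_Z_limit_eq_None[OF pos])
    show "expectation_on M (\<lambda>\<omega>. s ^ the (Z_limit \<omega>)) (\<lambda>\<omega>. Z_limit \<omega> \<noteq> None) = r - (r - s) powr A * D"
      if "s \<in> {0..1}" for s
      unfolding A_eq D_eq using that by (intro expectation_on_Z_limit[OF pos]) auto
  qed measurable
  show ?thesis
  proof (intro conjI impI ballI allI)
    show "A_seq a \<longlonglongrightarrow> A" "A \<in> {0..<1}" "D_seq r a c \<longlonglongrightarrow> D"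
      "(\<lambda>n. (r - c (Suc n)) powr (A_seq a n - A_seq a (Suc n))) has_prod D"
      unfolding A_eq D_eq
      using A_seq_tendsto A_nonneg A_less_1 D_limit(1) has_prod_D by auto
    show "(r - 1) powr (1 - A) \<le> D" "D \<le> r powr (1 - A)"
      unfolding A_eq D_eq by (rule D_bounds)+
    show "(\<lambda>n. \<P>(\<omega> in M. \<tau> \<omega> > enat n)) \<sim>[sequentially]
        (\<lambda>n. (ln r - ln (r - 1)) * A_seq a n * D_seq r a c n)" if "A = 0"
      unfolding \<tau> using that by (intro prob_alive_asymp) (simp add: A_eq)
    show "set_integrable M {\<omega>\<in>space M. \<tau> \<omega> > enat n} (\<lambda>\<omega>. real (the (Z n \<omega>)))" for n
      unfolding \<tau> by (rule mean_alive)
    show "(\<lambda>n. expectation_given M (\<lambda>\<omega>. real (the (Z n \<omega>))) (\<lambda>\<omega>. \<tau> \<omega> > enat n))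
        \<longlonglongrightarrow> inverse (r - 1) / (ln r - ln (r - 1))" if "A = 0"
      unfolding \<tau> using that by (intro mean_given_alive_tendsto) (simp add: A_eq)
    show "(\<lambda>n. expectation_given M (\<lambda>\<omega>. s ^ the (Z n \<omega>)) (\<lambda>\<omega>. \<tau> \<omega> > enat n))
        \<longlonglongrightarrow> (ln r - ln (r - s)) / (ln r - ln (r - 1))" if "A = 0" "s \<in> {0..1}" for s
      unfolding \<tau> using that by (intro expectation_power_given_alive_tendsto) (auto simp: A_eq)
    show "set_integrable M {\<omega>\<in>space M. \<tau>\<Delta> \<omega> > enat n} (\<lambda>\<omega>. real (the (Z n \<omega>)))" for n
      unfolding \<tau>\<Delta>_eq by (rule mean_not_killed)
    show "(\<lambda>n. expectation_on M (\<lambda>\<omega>. real (the (Z n \<omega>))) (\<lambda>\<omega>. \<tau>\<Delta> \<omega> > enat n))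
        \<longlonglongrightarrow> A * (r - 1) powr (A - 1) * D"
      unfolding \<tau>\<Delta>_eq mean_not_killed A_eq D_eq by (rule mean_tendsto)
  qed (use q q\<Delta> Q extinct survive Zinf in blast)+
qed

end
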